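(* There exists an oracle $\mathcal{V}\subseteq\mathbb{N}$ such that, relative to $\mathcal{V}$, there is no disjoint $\mathsf{CoNP}$ pair that is complete for the class of disjoint $\mathsf{CoNP}$ pairs with respect to polynomial-time reductions, but $\mathsf{E}^{\mathcal{V}}=\mathsf{NE}^{\mathcal{V}}$.
   Context: Relative to an oracle $A$: a disjoint $\mathsf{CoNP}^A$ pair is a pair $(U,V)$ of $\mathsf{CoNP}^A$ sets with $U\cap V=\varnothing$. $(U_0,U_1)$ is polynomially reducible to $(U'_0,U'_1)$ if there is a function $f$ computable in polynomial time with oracle $A$ such that for $i\in\{0,1\}$ and all $n$, $n\in U_i\to f(n)\in U'_i$. A pair is complete if every disjoint $\mathsf{CoNP}^A$ pair reduces to it. $\mathsf{E}^A$ and $\mathsf{NE}^A$ are the classes of languages decidable by deterministic, resp. nondeterministic, oracle machines with oracle $A$ in time $2^{O(n)}$ ($n$ the input length). *)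

theory Defs
  imports Main
begin

text \<open>Numbers are given to machines in binary, most significant bit first and without leading
  zeros; the length of an input is the number of its bits (so \<open>0\<close> has length \<open>0\<close>).\<close>

fun bits :: "nat \<Rightarrow> bool list" where
  "bits n = (if n = 0 then [] else bits (n div 2) @ [odd n])"

declare bits.simps [simp del]

definition nat_of_bits :: "bool list \<Rightarrow> nat" where
  "nat_of_bits w = horner_sum of_bool 2 (rev w)"

lemma nat_of_bits_bits: "nat_of_bits (bits n) = n"
proof (induction n rule: bits.induct)
  case (1 n)
  show ?case
  proof (cases "n = 0")
    case True
    then show ?thesis by (simp add: bits.simps nat_of_bits_def)
  next
    case False
    then have "nat_of_bits (bits n) = of_bool (odd n) + 2 * nat_of_bits (bits (n div 2))"
      by (subst bits.simps) (simp add: nat_of_bits_def)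
    with 1 False show ?thesis by simp
  qed
qed

text \<open>Multi-tape oracle Turing machines. Tapes are infinite to the right only; a left move in
  cell \<open>0\<close> leaves the head where it is. Tape \<open>0\<close> carries the input and, for machines computing
  functions, the output; tape \<open>1\<close> is the query tape. A machine is a finite set of instructions
  (state, symbols read, new state, symbols written with head moves), so that only finitely many
  states and finitely many of the auxiliary symbols are used.\<close>

datatype symb = Blank | Bit bool | Aux nat

datatype dir = Lft | Stay | Rgt

type_synonym tape = "(nat \<Rightarrow> symb) \<times> nat"

type_synonym instr = "nat \<times> symb list \<times> nat \<times> (symb \<times> dir) list"

type_synonym config = "nat \<times> tape list"

record machine =
  num_tapes :: nat
  instrs :: "instr set"
  start_state :: nat
  accept_state :: nat
  query_state :: nat
  yes_state :: nat
  no_state :: nat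

definition oracle_machine :: "machine \<Rightarrow> bool" where
  "oracle_machine M \<longleftrightarrow> 2 \<le> num_tapes M \<and> finite (instrs M) \<and>
     (\<forall>(q, rs, q', as) \<in> instrs M. length rs = num_tapes M \<and> length as = num_tapes M)"

definition deterministic :: "machine \<Rightarrow> bool" where
  "deterministic M \<longleftrightarrow>
     (\<forall>q rs q1 as1 q2 as2. (q, rs, q1, as1) \<in> instrs M \<longrightarrow> (q, rs, q2, as2) \<in> instrs M \<longrightarrow>
        q1 = q2 \<and> as1 = as2)"

fun read :: "tape \<Rightarrow> symb" where
  "read (f, h) = f h"

fun act :: "symb \<times> dir \<Rightarrow> tape \<Rightarrow> tape" where
  "act (s, d) (f, h) =
     (f(h := s), (case d of Lft \<Rightarrow> h - 1 | Stay \<Rightarrow> h | Rgt \<Rightarrow> h + 1))"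

text \<open>The number written on a tape: the value of the maximal block of bits starting in cell \<open>0\<close>.
  Tapes occurring in computations contain only finitely many non-blank cells, so the block is
  finite.\<close>

definition tape_number :: "tape \<Rightarrow> nat" where
  "tape_number T =
     nat_of_bits (map (\<lambda>i. fst T i = Bit True) [0..<(LEAST i. \<forall>b. fst T i \<noteq> Bit b)])"

definition input_tape :: "nat \<Rightarrow> tape" where
  "input_tape x = ((\<lambda>i. if i < length (bits x) then Bit (bits x ! i) else Blank), 0)"

definition blank_tape :: tape where
  "blank_tape = ((\<lambda>i. Blank), 0)"

definition init :: "machine \<Rightarrow> nat \<Rightarrow> config" where
  "init M x = (start_state M, input_tape x # replicate (num_tapes M - 1) blank_tape)"

inductive step :: "machine \<Rightarrow> nat set \<Rightarrow> config \<Rightarrow> config \<Rightarrow> bool" for M A where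
  instr: "\<lbrakk>q \<noteq> query_state M; (q, map read ts, q', as) \<in> instrs M\<rbrakk>
            \<Longrightarrow> step M A (q, ts) (q', map2 act as ts)"
| query: "step M A (query_state M, ts)
            (if tape_number (ts ! 1) \<in> A then yes_state M else no_state M, ts)"

definition halted :: "machine \<Rightarrow> nat set \<Rightarrow> config \<Rightarrow> bool" where
  "halted M A c \<longleftrightarrow> (\<nexists>c'. step M A c c')"

definition reaches :: "machine \<Rightarrow> nat set \<Rightarrow> nat \<Rightarrow> config \<Rightarrow> bool" where
  "reaches M A x c \<longleftrightarrow> (step M A)\<^sup>*\<^sup>* (init M x) c"

definition accepts :: "machine \<Rightarrow> nat set \<Rightarrow> nat \<Rightarrow> bool" where
  "accepts M A x \<longleftrightarrow> (\<exists>c. reaches M A x c \<and> halted M A c \<and> fst c = accept_state M)"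

text \<open>Every computation branch, on every input of length \<open>n\<close>, halts after at most \<open>t n\<close> steps.\<close>

definition runs_in_time :: "machine \<Rightarrow> nat set \<Rightarrow> (nat \<Rightarrow> nat) \<Rightarrow> bool" where
  "runs_in_time M A t \<longleftrightarrow>
     (\<forall>x k c. (step M A ^^ k) (init M x) c \<longrightarrow> k \<le> t (length (bits x)))"

definition DTIME :: "nat set \<Rightarrow> (nat \<Rightarrow> nat) \<Rightarrow> nat set set" where
  "DTIME A t = {{x. accepts M A x} | M.
     oracle_machine M \<and> deterministic M \<and> runs_in_time M A t}"

definition NTIME :: "nat set \<Rightarrow> (nat \<Rightarrow> nat) \<Rightarrow> nat set set" where
  "NTIME A t = {{x. accepts M A x} | M. oracle_machine M \<and> runs_in_time M A t}"

text \<open>The additive constants in the time bounds only matter for inputs of length \<open>0\<close> and \<open>1\<close>.\<close>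

definition E :: "nat set \<Rightarrow> nat set set" where
  "E A = (\<Union>c. DTIME A (\<lambda>n. 2 ^ (c * n + c)))"

definition NE :: "nat set \<Rightarrow> nat set set" where
  "NE A = (\<Union>c. NTIME A (\<lambda>n. 2 ^ (c * n + c)))"

definition NP :: "nat set \<Rightarrow> nat set set" where
  "NP A = (\<Union>c. NTIME A (\<lambda>n. n ^ c + c))"

definition CoNP :: "nat set \<Rightarrow> nat set set" where
  "CoNP A = {U. - U \<in> NP A}"

definition poly_time_computable :: "nat set \<Rightarrow> (nat \<Rightarrow> nat) \<Rightarrow> bool" where
  "poly_time_computable A f \<longleftrightarrow>
     (\<exists>M c. oracle_machine M \<and> deterministic M \<and> runs_in_time M A (\<lambda>n. n ^ c + c) \<and>
        (\<forall>x. \<exists>d. reaches M A x d \<and> halted M A d \<and> tape_number (snd d ! 0) = f x))"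

definition disjoint_CoNP_pair :: "nat set \<Rightarrow> nat set \<times> nat set \<Rightarrow> bool" where
  "disjoint_CoNP_pair A P \<longleftrightarrow> fst P \<in> CoNP A \<and> snd P \<in> CoNP A \<and> fst P \<inter> snd P = {}"

definition poly_reducible :: "nat set \<Rightarrow> nat set \<times> nat set \<Rightarrow> nat set \<times> nat set \<Rightarrow> bool" where
  "poly_reducible A P Q \<longleftrightarrow>
     (\<exists>f. poly_time_computable A f \<and>
        (\<forall>n. (n \<in> fst P \<longrightarrow> f n \<in> fst Q) \<and> (n \<in> snd P \<longrightarrow> f n \<in> snd Q)))"

definition complete_disjoint_CoNP_pair :: "nat set \<Rightarrow> nat set \<times> nat set \<Rightarrow> bool" where
  "complete_disjoint_CoNP_pair A Q \<longleftrightarrow>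
     disjoint_CoNP_pair A Q \<and> (\<forall>P. disjoint_CoNP_pair A P \<longrightarrow> poly_reducible A P Q)"

end

theory Submission
  imports Defs "HOL-Library.Countable_Set" "HOL-Library.Nat_Bijection"
begin

text \<open>Every set \<open>W\<close> of numbers determines a set \<open>V\<close> that agrees with \<open>W\<close> except on coding numbers. A
  coding number for a machine \<open>M\<close> and an input \<open>x\<close> has a binary expansion padded to exponential
  length, and it belongs to \<open>V\<close> iff \<open>M\<close> accepts \<open>x\<close> relative to \<open>V\<close> in fewer steps than that length;
  such a computation only queries smaller numbers, so the recursion is well founded. One query then
  decides a language in \<open>NE\<close>, whence \<open>E = NE\<close>.

  It remains to choose \<open>W\<close>, by finite extensions. Let a candidate pair be given by the complements
  of the languages of \<open>M\<^sub>0\<close> and \<open>M\<^sub>1\<close>, and let \<open>U\<^sub>s\<close> be the set of those \<open>x\<close> for which \<open>V\<close> contains no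
  witness \<open>(s, x, y)\<close> with \<open>y\<close> as long as \<open>x\<close>. To defeat a reduction \<open>f\<close>, work with inputs of a large
  length \<open>n\<close>. Because of the padding, only polynomially many coding numbers can be queried by the
  machines involved, and all of them can be frozen by fixing polynomially many witnesses. Some input
  \<open>x\<close> is untouched by this; remove all its witnesses and let \<open>z = f x\<close>. If some \<open>M\<^sub>s\<close> accepts \<open>z\<close>,
  add a witness for \<open>x\<close> on the other side that was not queried: now \<open>x\<close> lies in \<open>U\<^sub>s\<close> but \<open>z\<close>
  is not in the corresponding component of the candidate. If neither accepts, then \<open>z\<close> lies in both
  components, so the candidate is not disjoint. As long as this does not happen, every input keeps
  a witness on one side, and \<open>(U\<^sub>0, U\<^sub>1)\<close> is disjoint.\<close>

section \<open>Binary words\<close>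

lemma nat_of_bits_Nil [simp]: "nat_of_bits [] = 0"
  by (simp add: nat_of_bits_def)

lemma nat_of_bits_snoc [simp]: "nat_of_bits (w @ [b]) = 2 * nat_of_bits w + of_bool b"
  by (simp add: nat_of_bits_def)

lemma nat_of_bits_less: "nat_of_bits w < 2 ^ length w"
  by (induction w rule: rev_induct) auto

lemma nat_of_bits_True_pos: "0 < nat_of_bits (True # w)"
proof (induction w rule: rev_induct)
  case Nil
  show ?case using nat_of_bits_snoc[of "[]" True] by simp
next
  case (snoc b w)
  then show ?case using nat_of_bits_snoc[of "True # w" b] by simp
qed

lemma bits_nat_of_bits: "bits (nat_of_bits (True # w)) = True # w"
proof (induction w rule: rev_induct)
  case Nil
  show ?case using nat_of_bits_snoc[of "[]" True] by (simp add: bits.simps)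
next
  case (snoc b w)
  have "bits (2 * nat_of_bits (True # w) + of_bool b) = bits (nat_of_bits (True # w)) @ [b]"
    using nat_of_bits_True_pos[of w] by (subst bits.simps) (cases b; simp)
  then show ?case using snoc nat_of_bits_snoc[of "True # w" b] by simp
qed

lemma less_two_power_length_bits: "x < 2 ^ length (bits x)"
  using nat_of_bits_less[of "bits x"] by (simp add: nat_of_bits_bits)

lemma length_bits_le: "x < 2 ^ k \<Longrightarrow> length (bits x) \<le> k"
proof (induction x arbitrary: k rule: bits.induct)
  case (1 x)
  show ?case
  proof (cases "x = 0")
    case True
    then show ?thesis by (simp add: bits.simps)
  next
    case False
    then obtain j where k: "k = Suc j" using 1(2) by (cases k) auto
    then have "x div 2 < 2 ^ j" using 1(2) by auto
    then have "length (bits (x div 2)) \<le> j" using 1(1) False by blast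
    then show ?thesis using False k by (subst bits.simps) simp
  qed
qed

lemma length_bits_eq: "\<lbrakk>2 ^ n \<le> x; x < 2 ^ Suc n\<rbrakk> \<Longrightarrow> length (bits x) = Suc n"
proof -
  assume *: "2 ^ n \<le> x" "x < 2 ^ Suc n"
  have "(2::nat) ^ n < 2 ^ length (bits x)"
    using *(1) less_two_power_length_bits[of x] by (rule le_less_trans)
  then have "n < length (bits x)" by simp
  then show ?thesis using length_bits_le[OF *(2)] by simp
qed

text \<open>The leading ones make the word a canonical expansion, and the zero ends the unary tag;
  hence \<open>w\<close> may be any word, also one with leading zeros.\<close>

definition tagged :: "nat \<Rightarrow> bool list \<Rightarrow> nat" where
  "tagged k w = nat_of_bits (replicate (Suc k) True @ False # w)"

lemma bits_tagged: "bits (tagged k w) = replicate (Suc k) True @ False # w"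
  unfolding tagged_def using bits_nat_of_bits[of "replicate k True @ False # w"] by simp

lemma length_bits_tagged: "length (bits (tagged k w)) = k + 2 + length w"
  by (simp add: bits_tagged)

lemma tagged_eq_iff [simp]: "tagged k w = tagged k' w' \<longleftrightarrow> k = k' \<and> w = w'"
proof
  assume "tagged k w = tagged k' w'"
  then have *: "replicate (Suc k) True @ False # w = replicate (Suc k') True @ False # w'"
    by (metis bits_tagged)
  have tw: "takeWhile id (replicate j True @ False # v) = replicate j True" for j v
    by (induction j) auto
  have "replicate (Suc k) True = replicate (Suc k') True"
    using arg_cong[OF *, of "takeWhile id"] by (simp only: tw)
  then have "k = k'" by (metis length_replicate nat.inject)
  then show "k = k' \<and> w = w'" using * by simp
qed simp

lemma tagged_less: "tagged k w < 2 ^ (k + 2 + length w)"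
  using less_two_power_length_bits[of "tagged k w"] by (simp add: length_bits_tagged)

lemma tagged_ge: "2 ^ (k + 1 + length w) \<le> tagged k w"
proof (rule ccontr)
  assume "\<not> ?thesis"
  then have "length (bits (tagged k w)) \<le> k + 1 + length w" by (intro length_bits_le) simp
  then show False by (simp add: length_bits_tagged)
qed

text \<open>Interleaving lets a machine write input and guess in a single pass, the length of the
  guess being dictated by the input.\<close>

definition interleave :: "bool list \<Rightarrow> bool list \<Rightarrow> bool list" where
  "interleave bs ys = concat (map2 (\<lambda>b g. [b, g]) bs ys)"

lemma interleave_Nil [simp]: "interleave [] [] = []"
  by (simp add: interleave_def)

lemma interleave_snoc:
  "length bs = length ys \<Longrightarrow> interleave (bs @ [b]) (ys @ [g]) = interleave bs ys @ [b, g]"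
  by (simp add: interleave_def)

lemma length_interleave: "length bs = length ys \<Longrightarrow> length (interleave bs ys) = 2 * length bs"
  by (induction bs ys rule: list_induct2) (auto simp: interleave_def)

lemma interleave_eqD:
  "\<lbrakk>length bs = length ys; length bs' = length ys'; interleave bs ys = interleave bs' ys'\<rbrakk>
    \<Longrightarrow> bs = bs' \<and> ys = ys'"
proof (induction bs ys arbitrary: bs' ys' rule: list_induct2)
  case Nil
  then show ?case using length_interleave[of bs' ys'] by simp
next
  case (Cons b bs y ys)
  have "length (interleave bs' ys') = 2 * length (b # bs)"
    using Cons.hyps Cons.prems length_interleave[of "b # bs" "y # ys"] by simp
  then obtain b' cs y' zs where "bs' = b' # cs" "ys' = y' # zs"
    using Cons.prems(1) by (cases bs'; cases ys') (auto simp: interleave_def)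
  then show ?case using Cons.IH[of cs zs] Cons.prems by (simp add: interleave_def)
qed

section \<open>Runs and their queries\<close>

text \<open>A query has a successor under either answer: the oracle decides which step is taken, not
  whether there is one.\<close>

lemma halted_cong: "halted M A c = halted M B c"
proof -
  have "\<exists>c'. step M B c c'" if "step M A c c'" for A B c'
    using that by cases (blast intro: step.intros)+
  then show ?thesis unfolding halted_def by blast
qed

text \<open>The explicit clock makes acceptance depend on finitely many oracle values even for
  machines without a time bound.\<close>

definition accepts_within :: "machine \<Rightarrow> nat set \<Rightarrow> nat \<Rightarrow> nat \<Rightarrow> bool" where
  "accepts_within M A x t \<longleftrightarrow>
     (\<exists>k\<le>t. \<exists>c. (step M A ^^ k) (init M x) c \<and> halted M A c \<and> fst c = accept_state M)"

lemma accepts_within_imp_accepts: "accepts_within M A x t \<Longrightarrow> accepts M A x"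
  unfolding accepts_within_def accepts_def reaches_def by (meson relpowp_imp_rtranclp)

lemma accepts_within_iff:
  assumes "runs_in_time M A t" "t (length (bits x)) \<le> u"
  shows "accepts_within M A x u \<longleftrightarrow> accepts M A x"
proof
  assume "accepts M A x"
  then obtain k c where "(step M A ^^ k) (init M x) c" "halted M A c" "fst c = accept_state M"
    unfolding accepts_def reaches_def by (meson rtranclp_imp_relpowp)
  moreover from this have "k \<le> u"
    using assms unfolding runs_in_time_def by (meson le_trans)
  ultimately show "accepts_within M A x u" unfolding accepts_within_def by blast
qed (rule accepts_within_imp_accepts)

text \<open>Only tape \<open>0\<close> starts with \<open>n\<close> written cells. For tape
  \<open>1\<close> this bounds the queries, for tape \<open>0\<close> the output.\<close>

definition tapes_bounded :: "machine \<Rightarrow> nat \<Rightarrow> nat \<Rightarrow> config \<Rightarrow> bool" where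
  "tapes_bounded M n k c \<longleftrightarrow> length (snd c) = num_tapes M \<and>
     (\<forall>j<num_tapes M. snd (snd c ! j) \<le> k \<and>
        (\<forall>i\<ge>(if j = 0 then n else 0) + k. fst (snd c ! j) i = Blank))"

lemma tapes_bounded_init:
  assumes "oracle_machine M"
  shows "tapes_bounded M (length (bits x)) 0 (init M x)"
proof -
  have "(input_tape x # replicate (num_tapes M - 1) blank_tape) ! j =
      (if j = 0 then input_tape x else blank_tape)" if "j < num_tapes M" for j
    using that by (cases j) auto
  then show ?thesis using assms
    by (auto simp: tapes_bounded_def init_def oracle_machine_def input_tape_def blank_tape_def)
qed

lemma act_bounded:
  assumes "snd T \<le> k" "\<forall>i\<ge>n + k. fst T i = Blank"
  shows "snd (act a T) \<le> Suc k \<and> (\<forall>i\<ge>n + Suc k. fst (act a T) i = Blank)"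
  using assms by (cases a; cases T) (auto split: dir.split)

lemma tapes_bounded_step:
  assumes "oracle_machine M" "tapes_bounded M n k c" "step M A c c'"
  shows "tapes_bounded M n (Suc k) c'"
  using assms(3)
proof cases
  case (instr q ts q' as)
  have len: "length as = num_tapes M" "length ts = num_tapes M"
    using instr assms(1,2) by (auto simp: oracle_machine_def tapes_bounded_def)
  show ?thesis unfolding tapes_bounded_def
  proof (intro conjI allI impI)
    show "length (snd c') = num_tapes M" using instr len by simp
  next
    fix j assume j: "j < num_tapes M"
    have b: "snd (ts ! j) \<le> k" "\<forall>i\<ge>(if j = 0 then n else 0) + k. fst (ts ! j) i = Blank"
      using instr assms(2) j by (auto simp: tapes_bounded_def)
    have e: "snd c' ! j = act (as ! j) (ts ! j)" using instr len j by simp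
    show "snd (snd c' ! j) \<le> Suc k" using act_bounded[OF b] e by simp
    show "fst (snd c' ! j) i = Blank" if "(if j = 0 then n else 0) + Suc k \<le> i" for i
      using act_bounded[OF b] e that by simp
  qed
next
  case query
  then show ?thesis using assms(2) by (fastforce simp: tapes_bounded_def)
qed

lemma tapes_bounded_run:
  assumes "oracle_machine M"
  shows "(step M A ^^ k) (init M x) c \<Longrightarrow> tapes_bounded M (length (bits x)) k c"
  by (induction k arbitrary: c)
    (auto simp: tapes_bounded_init assms intro: tapes_bounded_step[OF assms])

lemma tape_number_less:
  assumes "fst T k = Blank"
  shows "tape_number T < 2 ^ k"
proof -
  let ?m = "LEAST i. \<forall>b. fst T i \<noteq> Bit b"
  have "tape_number T < 2 ^ ?m"
    using nat_of_bits_less[of "map (\<lambda>i. fst T i = Bit True) [0..<?m]"]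
    by (simp add: tape_number_def)
  also have "?m \<le> k" using assms by (intro Least_le) simp
  then have "(2::nat) ^ ?m \<le> 2 ^ k" by simp
  finally show ?thesis .
qed

lemma output_length:
  assumes "oracle_machine M" "(step M A ^^ k) (init M x) c"
  shows "length (bits (tape_number (snd c ! 0))) \<le> length (bits x) + k"
  using tapes_bounded_run[OF assms] assms(1)
  by (intro length_bits_le tape_number_less) (auto simp: tapes_bounded_def oracle_machine_def)

text \<open>Queries in a run of length \<open>k\<close> are below \<open>2 ^ k\<close> because the query tape is initially
  blank.\<close>

lemma run_queries:
  assumes M: "oracle_machine M"
  shows "(step M A ^^ k) (init M x) c \<Longrightarrow> \<exists>Q. finite Q \<and> card Q \<le> k \<and> Q \<subseteq> {..<2 ^ k} \<and>
           (\<forall>B. (\<forall>u\<in>Q. u \<in> A \<longleftrightarrow> u \<in> B) \<longrightarrow> (step M B ^^ k) (init M x) c)"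
proof (induction k arbitrary: c)
  case 0
  then show ?case by (intro exI[of _ "{}"]) auto
next
  case (Suc k)
  then obtain d where d: "(step M A ^^ k) (init M x) d" "step M A d c" by auto
  from Suc.IH[OF d(1)] obtain Q where Q: "finite Q" "card Q \<le> k" "Q \<subseteq> {..<2 ^ k}"
    and run: "\<And>B. \<forall>u\<in>Q. u \<in> A \<longleftrightarrow> u \<in> B \<Longrightarrow> (step M B ^^ k) (init M x) d" by blast
  \<comment> \<open>The number on the query tape is recorded at every step, whether or not it is
    asked; the cost is still one per step.\<close>
  let ?u = "tape_number (snd d ! 1)"
  have "fst (snd d ! 1) k = Blank"
    using tapes_bounded_run[OF M d(1)] M by (auto simp: tapes_bounded_def oracle_machine_def)
  then have u: "?u < 2 ^ k" by (rule tape_number_less)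
  have st: "step M B d c" if "?u \<in> A \<longleftrightarrow> ?u \<in> B" for B
    using d(2)
  proof cases
    case (query ts)
    then show ?thesis using step.query[of M B ts] that by simp
  qed (auto intro: step.instr)
  show ?case
  proof (intro exI[of _ "insert ?u Q"] conjI allI impI)
    show "card (insert ?u Q) \<le> Suc k" using Q by (simp add: card_insert_if)
    show "insert ?u Q \<subseteq> {..<2 ^ Suc k}" using Q(3) u by auto
    show "(step M B ^^ Suc k) (init M x) c" if "\<forall>u\<in>insert ?u Q. u \<in> A \<longleftrightarrow> u \<in> B" for B
      using run[of B] st[of B] that by auto
  qed (use Q in simp)
qed

text \<open>A single accepting run suffices, so acceptance is secured by few oracle values.
  Rejection concerns all runs; \<open>accepts_within_cong\<close> deals with it by fixing everything
  below \<open>2 ^ t\<close>.\<close>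

lemma accepts_within_queries:
  assumes "oracle_machine M" "accepts_within M A x t"
  shows "\<exists>Q. finite Q \<and> card Q \<le> t \<and> Q \<subseteq> {..<2 ^ t} \<and>
           (\<forall>B. (\<forall>u\<in>Q. u \<in> A \<longleftrightarrow> u \<in> B) \<longrightarrow> accepts_within M B x t)"
proof -
  obtain k c where k: "k \<le> t" "(step M A ^^ k) (init M x) c" "halted M A c" "fst c = accept_state M"
    using assms(2) unfolding accepts_within_def by blast
  from run_queries[OF assms(1) k(2)] obtain Q where Q: "finite Q" "card Q \<le> k" "Q \<subseteq> {..<2 ^ k}"
    "\<And>B. \<forall>u\<in>Q. u \<in> A \<longleftrightarrow> u \<in> B \<Longrightarrow> (step M B ^^ k) (init M x) c" by blast
  have "(2::nat) ^ k \<le> 2 ^ t" using k(1) by simp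
  with Q(3) have "Q \<subseteq> {..<2 ^ t}" by (meson lessThan_subset_iff order_trans)
  then show ?thesis using Q k halted_cong[of M A c] unfolding accepts_within_def
    by (intro exI[of _ Q]) (metis order_trans)
qed

lemma accepts_within_cong:
  assumes "oracle_machine M" "\<And>u. u < 2 ^ t \<Longrightarrow> u \<in> A \<longleftrightarrow> u \<in> B"
  shows "accepts_within M A x t \<longleftrightarrow> accepts_within M B x t"
proof -
  have "accepts_within M B x t" if "accepts_within M A x t" "\<And>u. u < 2 ^ t \<Longrightarrow> u \<in> A \<longleftrightarrow> u \<in> B" for A B
    using accepts_within_queries[OF assms(1) that(1)] that(2)
    by (metis lessThan_iff subset_iff)
  then show ?thesis using assms(2) by blast
qed

section \<open>Deterministic runs and truncated runs\<close>

lemma deterministic_step: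
  assumes "deterministic M" "step M A c d" "step M A c d'"
  shows "d = d'"
  using assms(2)
proof cases
  case (instr q ts q1 as1)
  from assms(3) obtain q2 as2 where "(q, map read ts, q2, as2) \<in> instrs M" "d' = (q2, map2 act as2 ts)"
    using instr by (auto elim: step.cases)
  moreover from this(1) have "q2 = q1 \<and> as2 = as1"
    using instr assms(1) unfolding deterministic_def by blast
  ultimately show ?thesis using instr by simp
next
  case query
  then show ?thesis using assms(3) by (auto elim!: step.cases)
qed

text \<open>All runs from \<open>c0\<close> are initial segments of the halting one; this yields
  time bounds as well as uniqueness of the result.\<close>

lemma deterministic_run:
  assumes "deterministic M"
  shows "\<lbrakk>(step M A ^^ N) c0 c; halted M A c; (step M A ^^ k) c0 d\<rbrakk>
    \<Longrightarrow> k \<le> N \<and> (step M A ^^ (N - k)) d c"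
proof (induction k arbitrary: d)
  case (Suc k)
  then obtain d' where d': "(step M A ^^ k) c0 d'" "step M A d' d" by auto
  then have IH: "k \<le> N" "(step M A ^^ (N - k)) d' c" using Suc by auto
  show ?case
  proof (cases "N - k")
    case 0
    then have "d' = c" using IH(2) by simp
    then show ?thesis using d'(2) Suc.prems(2) unfolding halted_def by blast
  next
    case (Suc m)
    then obtain d2 where "step M A d' d2" "(step M A ^^ m) d2 c"
      using IH(2) by (metis relpowp_Suc_D2)
    moreover have "m = N - Suc k" "Suc k \<le> N" using Suc by auto
    ultimately show ?thesis using deterministic_step[OF assms d'(2)] by blast
  qed
qed simp

lemma deterministic_halted_unique:
  assumes "deterministic M" "(step M A ^^ k) c0 c" "halted M A c" "(step M A ^^ k') c0 c'"
    "halted M A c'"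
  shows "c = c'"
proof -
  have "k' \<le> k" "(step M A ^^ (k - k')) c' c"
    using deterministic_run[OF assms(1-4)] by auto
  moreover have "k \<le> k'"
    using deterministic_run[OF assms(1) assms(4,5,2)] by auto
  ultimately show ?thesis by simp
qed

text \<open>Enumerated machines need not halt, so the diagonalization works with runs cut off after
  \<open>t\<close> steps.\<close>

lemma exists_run:
  "\<exists>k c. (step M A ^^ k) c0 c \<and> k \<le> t \<and> (halted M A c \<or> k = t)"
proof (induction t)
  case (Suc t)
  then obtain k c where kc: "(step M A ^^ k) c0 c" "k \<le> t" "halted M A c \<or> k = t" by blast
  show ?case
  proof (cases "halted M A c")
    case True
    then show ?thesis using kc by (meson le_SucI)
  next
    case False
    then obtain c' where "step M A c c'" unfolding halted_def by blast
    then have "(step M A ^^ Suc k) c0 c'" using kc(1) by auto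
    then show ?thesis using False kc by blast
  qed
qed auto

section \<open>Two concrete machines\<close>

text \<open>The head rests on the first blank cell, so that writing a bit with a right move appends
  it.\<close>

definition word_tape :: "bool list \<Rightarrow> tape" where
  "word_tape w = ((\<lambda>i. if i < length w then Bit (w ! i) else Blank), length w)"

lemma word_tape_Nil: "word_tape [] = blank_tape"
  by (simp add: word_tape_def blank_tape_def)

lemma read_word_tape [simp]: "read (word_tape w) = Blank"
  by (simp add: word_tape_def)

lemma act_word_tape [simp]: "act (Bit b, Rgt) (word_tape w) = word_tape (w @ [b])"
  by (auto simp: word_tape_def nth_append fun_eq_iff less_Suc_eq)

lemma act_Stay [simp]: "act (read T, Stay) T = T"
  by (cases T) simp

lemma act_Blank_word_tape [simp]: "act (Blank, Stay) (word_tape w) = word_tape w"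
  using act_Stay[of "word_tape w"] by simp

lemma tape_number_word_tape [simp]: "tape_number (word_tape w) = nat_of_bits w"
proof -
  have "(LEAST i. \<forall>b. fst (word_tape w) i \<noteq> Bit b) = length w"
    by (rule Least_equality) (auto simp: word_tape_def split: if_splits intro: ccontr)
  moreover have "map (\<lambda>i. fst (word_tape w) i = Bit True) [0..<length w] = w"
    by (rule nth_equalityI) (auto simp: word_tape_def)
  ultimately show ?thesis by (simp add: tape_number_def)
qed

definition input_at :: "nat \<Rightarrow> nat \<Rightarrow> tape" where
  "input_at x h = (fst (input_tape x), h)"

lemma input_at_0: "input_tape x = input_at x 0"
  by (simp add: input_at_def input_tape_def)

lemma read_input_at [simp]:
  "read (input_at x h) = (if h < length (bits x) then Bit (bits x ! h) else Blank)"
  by (simp add: input_at_def input_tape_def)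

lemma act_input_at:
  "s = read (input_at x h) \<Longrightarrow> act (s, Rgt) (input_at x h) = input_at x (Suc h)"
  "s = read (input_at x h) \<Longrightarrow> act (s, Stay) (input_at x h) = input_at x h"
  by (simp_all add: input_at_def)

definition symbols :: "nat \<Rightarrow> symb set" where
  "symbols K = insert Blank (range Bit \<union> Aux ` {..K})"

lemma finite_symbols: "finite (symbols K)"
  by (simp add: symbols_def)

lemma symbols_simps [simp]: "Blank \<in> symbols K" "Bit b \<in> symbols K" "Aux d \<in> symbols K \<longleftrightarrow> d \<le> K"
  by (auto simp: symbols_def)

text \<open>Common frame of both machines: the states up to \<open>k + 1\<close> serve to write the
  tag, \<open>k + 4\<close> asks the one query, and both answer states halt. Admitting only
  \<open>symbols K\<close> keeps the instruction set finite.\<close>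

definition query_machine ::
  "nat \<Rightarrow> nat \<Rightarrow> nat \<Rightarrow> (nat \<Rightarrow> symb list \<Rightarrow> (nat \<times> (symb \<times> dir) list) set) \<Rightarrow> machine" where
  "query_machine t K k prog = \<lparr>num_tapes = t,
     instrs = {(q, rs, q', as). q < k + 4 \<and> set rs \<subseteq> symbols K \<and> length rs = t \<and> (q', as) \<in> prog q rs},
     start_state = 0, accept_state = k + 5, query_state = k + 4, yes_state = k + 5, no_state = k + 6\<rparr>"

lemma query_machine_simps [simp]:
  "num_tapes (query_machine t K k prog) = t"
  "start_state (query_machine t K k prog) = 0"
  "accept_state (query_machine t K k prog) = k + 5"
  "query_state (query_machine t K k prog) = k + 4"
  "yes_state (query_machine t K k prog) = k + 5"
  "no_state (query_machine t K k prog) = k + 6"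
  "(q, rs, q', as) \<in> instrs (query_machine t K k prog) \<longleftrightarrow>
     q < k + 4 \<and> set rs \<subseteq> symbols K \<and> length rs = t \<and> (q', as) \<in> prog q rs"
  by (simp_all add: query_machine_def)

lemma oracle_machine_query_machine:
  assumes "2 \<le> t" "\<And>q rs. finite (prog q rs)"
    "\<And>q rs q' as. (q', as) \<in> prog q rs \<Longrightarrow> length as = t"
  shows "oracle_machine (query_machine t K k prog)"
proof -
  let ?R = "{rs. set rs \<subseteq> symbols K \<and> length rs = t}"
  have "finite (SIGMA q:{..<k + 4}. SIGMA rs:?R. prog q rs)"
    using assms(2) finite_lists_length_eq[OF finite_symbols] by (intro finite_SigmaI) auto
  moreover have "instrs (query_machine t K k prog) = (SIGMA q:{..<k + 4}. SIGMA rs:?R. prog q rs)"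
    by (auto simp: query_machine_def)
  ultimately show ?thesis using assms(1,3) by (auto simp: oracle_machine_def)
qed

lemma step_query_machineI:
  assumes "q < k + 4" "(q', as) \<in> prog q (map read ts)" "length ts = t"
    "\<forall>T\<in>set ts. read T \<in> symbols K" "ts' = map2 act as ts"
  shows "step (query_machine t K k prog) A (q, ts) (q', ts')"
  unfolding assms(5) using assms(1-4) by (intro step.instr) auto

lemma step_query_machineE:
  assumes "step (query_machine t K k prog) A (q, ts) c'"
  obtains q' as where "q < k + 4" "(q', as) \<in> prog q (map read ts)" "c' = (q', map2 act as ts)"
  | "q = k + 4" "c' = (if tape_number (ts ! 1) \<in> A then k + 5 else k + 6, ts)"
  using assms by cases auto

lemma halted_query_machine: "k + 4 < q \<Longrightarrow> halted (query_machine t K k prog) A (q, ts)"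
  unfolding halted_def by (auto elim!: step_query_machineE)

subsection \<open>Guessing a witness\<close>

text \<open>State \<open>k + 2\<close> copies the scanned input bit while staying on it, and
  \<open>k + 3\<close> appends a guessed bit and moves on, which produces the interleaved
  word.\<close>

definition guess_prog :: "nat \<Rightarrow> nat \<Rightarrow> symb list \<Rightarrow> (nat \<times> (symb \<times> dir) list) set" where
  "guess_prog k q rs =
    (if q \<le> k then {(q + 1, [(rs ! 0, Stay), (Bit True, Rgt)])}
     else if q = k + 1 then {(k + 2, [(rs ! 0, Stay), (Bit False, Rgt)])}
     else if q = k + 2 then
       (case rs ! 0 of Bit b \<Rightarrow> {(k + 3, [(rs ! 0, Stay), (Bit b, Rgt)])}
        | _ \<Rightarrow> {(k + 4, [(rs ! 0, Stay), (rs ! 1, Stay)])})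
     else (\<lambda>g. (k + 2, [(rs ! 0, Rgt), (Bit g, Rgt)])) ` UNIV)"

definition guess_machine :: "nat \<Rightarrow> machine" where
  "guess_machine k = query_machine 2 0 k (guess_prog k)"

lemma oracle_machine_guess_machine: "oracle_machine (guess_machine k)"
  unfolding guess_machine_def
  by (rule oracle_machine_query_machine) (auto simp: guess_prog_def split: symb.splits if_splits)

definition tag_word :: "nat \<Rightarrow> bool list" where
  "tag_word k = replicate (Suc k) True @ [False]"

lemma nat_of_bits_tag_word: "nat_of_bits (tag_word k @ w) = tagged k w"
  by (simp add: tag_word_def tagged_def)

text \<open>The last argument bounds the number of remaining steps.\<close>

inductive guess_inv :: "nat \<Rightarrow> nat set \<Rightarrow> nat \<Rightarrow> config \<Rightarrow> nat \<Rightarrow> bool" for k A x where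
  prefix: "i \<le> k + 1 \<Longrightarrow> guess_inv k A x (i, [input_at x 0, word_tape (replicate i True)])
     (2 * length (bits x) + 2 + (k + 2 - i))"
| copy: "h \<le> length (bits x) \<Longrightarrow> length y = h \<Longrightarrow>
     guess_inv k A x (k + 2, [input_at x h, word_tape (tag_word k @ interleave (take h (bits x)) y)])
       (2 * (length (bits x) - h) + 2)"
| guess: "h < length (bits x) \<Longrightarrow> length y = h \<Longrightarrow>
     guess_inv k A x (k + 3, [input_at x h,
         word_tape (tag_word k @ interleave (take h (bits x)) y @ [bits x ! h])])
       (2 * (length (bits x) - h) + 1)"
| ask: "length y = length (bits x) \<Longrightarrow>
     guess_inv k A x (k + 4, [input_at x (length (bits x)),
         word_tape (tag_word k @ interleave (bits x) y)]) 1"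
| yes: "length y = length (bits x) \<Longrightarrow> tagged k (interleave (bits x) y) \<in> A \<Longrightarrow>
     guess_inv k A x (k + 5, ts) 0"
| no: "guess_inv k A x (k + 6, ts) 0"

text \<open>The decreasing bound gives the running time, and the invariant itself shows that the
  accepting state is entered only after a positive answer for some guess.\<close>

lemma guess_inv_step:
  assumes "guess_inv k A x c r" "step (guess_machine k) A c c'"
  shows "\<exists>r'<r. guess_inv k A x c' r'"
  using assms(1)
proof cases
  case (prefix i)
  have st: "step (query_machine 2 0 k (guess_prog k)) A
      (i, [input_at x 0, word_tape (replicate i True)]) c'"
    using assms(2) prefix by (simp add: guess_machine_def)
  show ?thesis
  proof (cases "i \<le> k")
    case True
    then have "c' = (Suc i, [input_at x 0, word_tape (replicate (Suc i) True)])"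
      using st by (auto elim!: step_query_machineE simp: guess_prog_def act_input_at
        replicate_append_same)
    then show ?thesis using guess_inv.prefix[of "Suc i" k A x] True prefix
      by (intro exI[of _ "2 * length (bits x) + 2 + (k + 2 - Suc i)"]) auto
  next
    case False
    then have "i = k + 1" using prefix by simp
    then have "c' = (k + 2, [input_at x 0, word_tape (tag_word k)])"
      using st by (auto elim!: step_query_machineE simp: guess_prog_def act_input_at tag_word_def)
    then show ?thesis using guess_inv.copy[of 0 x "[]" k A] \<open>i = k + 1\<close> prefix
      by (intro exI[of _ "2 * length (bits x) + 2"]) auto
  qed
next
  case (copy h y)
  have st: "step (query_machine 2 0 k (guess_prog k)) A
      (k + 2, [input_at x h, word_tape (tag_word k @ interleave (take h (bits x)) y)]) c'"
    using assms(2) copy by (simp add: guess_machine_def)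
  show ?thesis
  proof (cases "h < length (bits x)")
    case True
    then have "c' = (k + 3, [input_at x h,
         word_tape (tag_word k @ interleave (take h (bits x)) y @ [bits x ! h])])"
      using st by (auto elim!: step_query_machineE simp: guess_prog_def act_input_at)
    then show ?thesis using guess_inv.guess[of h x y k A] True copy by auto
  next
    case False
    then have "c' = (k + 4, [input_at x h, word_tape (tag_word k @ interleave (take h (bits x)) y)])"
      using st by (auto elim!: step_query_machineE simp: guess_prog_def act_input_at)
    then show ?thesis using guess_inv.ask[of y x k A] False copy by auto
  qed
next
  case (guess h y)
  have st: "step (query_machine 2 0 k (guess_prog k)) A
      (k + 3, [input_at x h, word_tape (tag_word k @ interleave (take h (bits x)) y @ [bits x ! h])]) c'"
    using assms(2) guess by (simp add: guess_machine_def)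
  have "\<exists>g. c' = (k + 2, [input_at x (Suc h),
      word_tape (tag_word k @ interleave (take (Suc h) (bits x)) (y @ [g]))])"
    using st guess by (auto elim!: step_query_machineE
      simp: guess_prog_def act_input_at take_Suc_conv_app_nth interleave_snoc) blast
  then obtain g where "c' = (k + 2, [input_at x (Suc h),
      word_tape (tag_word k @ interleave (take (Suc h) (bits x)) (y @ [g]))])" by blast
  moreover have "guess_inv k A x \<dots> (2 * (length (bits x) - Suc h) + 2)"
    by (rule guess_inv.copy) (use guess in auto)
  ultimately show ?thesis using guess by (intro exI[of _ "2 * (length (bits x) - Suc h) + 2"]) auto
next
  case (ask y)
  have "step (query_machine 2 0 k (guess_prog k)) A
      (k + 4, [input_at x (length (bits x)), word_tape (tag_word k @ interleave (bits x) y)]) c'"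
    using assms(2) ask by (simp add: guess_machine_def)
  then show ?thesis using ask
    by (auto elim!: step_query_machineE simp: nat_of_bits_tag_word intro: guess_inv.intros)
next
  case (yes y ts)
  then have "halted (guess_machine k) A c"
    unfolding guess_machine_def by (simp add: halted_query_machine)
  then show ?thesis using assms(2) unfolding halted_def by blast
next
  case (no ts)
  then have "halted (guess_machine k) A c"
    unfolding guess_machine_def by (simp add: halted_query_machine)
  then show ?thesis using assms(2) unfolding halted_def by blast
qed

lemma init_guess_machine: "init (guess_machine k) x = (0, [input_at x 0, word_tape []])"
  by (simp add: init_def guess_machine_def input_at_0 word_tape_Nil)

lemma guess_inv_run:
  "(step (guess_machine k) A ^^ j) (init (guess_machine k) x) c \<Longrightarrow>
    \<exists>r. j + r \<le> 2 * length (bits x) + k + 4 \<and> guess_inv k A x c r"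
proof (induction j arbitrary: c)
  case 0
  then show ?case using guess_inv.prefix[of 0 k A x]
    by (intro exI[of _ "2 * length (bits x) + k + 4"]) (auto simp: init_guess_machine eval_nat_numeral)
next
  case (Suc j)
  then obtain d where d: "(step (guess_machine k) A ^^ j) (init (guess_machine k) x) d"
    "step (guess_machine k) A d c" by auto
  then obtain r where r: "j + r \<le> 2 * length (bits x) + k + 4" "guess_inv k A x d r"
    using Suc.IH by blast
  from guess_inv_step[OF r(2) d(2)] obtain r' where "r' < r" "guess_inv k A x c r'" by blast
  then show ?case using r(1) by (intro exI[of _ r']) auto
qed

lemma guess_machine_time: "runs_in_time (guess_machine k) A (\<lambda>n. n ^ (k + 5) + (k + 5))"
  unfolding runs_in_time_def
proof (intro allI impI)
  fix x j c assume "(step (guess_machine k) A ^^ j) (init (guess_machine k) x) c"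
  then have j: "j \<le> 2 * length (bits x) + k + 4" using guess_inv_run by fastforce
  \<comment> \<open>Exponent and additive constant coincide in \<open>NP\<close>. Of the constant
    \<open>k + 5\<close>, the part \<open>k + 4\<close> pays for the fixed cost and the last unit
    for inputs of length \<open>1\<close>.\<close>
  have "2 * n \<le> n ^ (k + 5) + 1" for n :: nat
  proof (cases "n \<le> 1")
    case False
    then have "2 * n \<le> n ^ 2" by (simp add: power2_eq_square)
    also have "\<dots> \<le> n ^ (k + 5)" using False by (intro power_increasing) auto
    finally show ?thesis by simp
  qed (auto simp: le_Suc_eq)
  from this[of "length (bits x)"] j show "j \<le> length (bits x) ^ (k + 5) + (k + 5)" by linarith
qed

text \<open>The branch that guesses exactly \<open>y\<close>; it supplies the accepting run for a
  given witness.\<close>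

lemma guess_machine_copy:
  assumes "length y = length (bits x)"
  shows "h \<le> length (bits x) \<Longrightarrow>
    (step (guess_machine k) A)\<^sup>*\<^sup>* (init (guess_machine k) x)
      (k + 2, [input_at x h, word_tape (tag_word k @ interleave (take h (bits x)) (take h y))])"
proof (induction h)
  case 0
  have pre: "i \<le> k + 1 \<Longrightarrow> (step (guess_machine k) A)\<^sup>*\<^sup>* (init (guess_machine k) x)
      (i, [input_at x 0, word_tape (replicate i True)])" for i
  proof (induction i)
    case (Suc i)
    have "step (guess_machine k) A (i, [input_at x 0, word_tape (replicate i True)])
        (Suc i, [input_at x 0, word_tape (replicate (Suc i) True)])"
      unfolding guess_machine_def using Suc.prems
      by (intro step_query_machineI[where as = "[(read (input_at x 0), Stay), (Bit True, Rgt)]"])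
        (auto simp: guess_prog_def act_input_at replicate_append_same)
    then show ?case using Suc by (meson Suc_leD rtranclp.simps)
  qed (simp add: init_guess_machine)
  have "step (guess_machine k) A (k + 1, [input_at x 0, word_tape (replicate (k + 1) True)])
      (k + 2, [input_at x 0, word_tape (tag_word k)])"
    unfolding guess_machine_def
    by (intro step_query_machineI[where as = "[(read (input_at x 0), Stay), (Bit False, Rgt)]"])
      (auto simp: guess_prog_def act_input_at tag_word_def)
  then show ?case using pre[of "k + 1"] by (simp add: rtranclp.rtrancl_into_rtrancl)
next
  case (Suc h)
  let ?w = "tag_word k @ interleave (take h (bits x)) (take h y)"
  have h: "h < length (bits x)" "h < length y" using Suc.prems assms by auto
  have "step (guess_machine k) A (k + 2, [input_at x h, word_tape ?w])
      (k + 3, [input_at x h, word_tape (?w @ [bits x ! h])])"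
    unfolding guess_machine_def using h
    by (intro step_query_machineI[where
          as = "[(read (input_at x h), Stay), (Bit (bits x ! h), Rgt)]"])
      (auto simp: guess_prog_def act_input_at)
  moreover have "step (guess_machine k) A (k + 3, [input_at x h, word_tape (?w @ [bits x ! h])])
      (k + 2, [input_at x (Suc h), word_tape (?w @ [bits x ! h] @ [y ! h])])"
    unfolding guess_machine_def using h
    by (intro step_query_machineI[where as = "[(read (input_at x h), Rgt), (Bit (y ! h), Rgt)]"])
      (auto simp: guess_prog_def act_input_at)
  moreover have "?w @ [bits x ! h] @ [y ! h] =
      tag_word k @ interleave (take (Suc h) (bits x)) (take (Suc h) y)"
    using h by (simp add: take_Suc_conv_app_nth interleave_snoc)
  ultimately show ?case using Suc.IH h(1)
    by (metis (no_types, lifting) less_imp_le rtranclp.rtrancl_into_rtrancl)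
qed

lemma accepts_guess_machine:
  "accepts (guess_machine k) A x \<longleftrightarrow>
    (\<exists>y. length y = length (bits x) \<and> tagged k (interleave (bits x) y) \<in> A)"
proof
  assume "accepts (guess_machine k) A x"
  then obtain j c where "(step (guess_machine k) A ^^ j) (init (guess_machine k) x) c"
    "fst c = k + 5"
    unfolding accepts_def reaches_def by (auto simp: guess_machine_def dest!: rtranclp_imp_relpowp)
  then obtain r where "guess_inv k A x c r" "fst c = k + 5" using guess_inv_run by blast
  then show "\<exists>y. length y = length (bits x) \<and> tagged k (interleave (bits x) y) \<in> A"
    by cases auto
next
  assume "\<exists>y. length y = length (bits x) \<and> tagged k (interleave (bits x) y) \<in> A"
  then obtain y where y: "length y = length (bits x)" "tagged k (interleave (bits x) y) \<in> A" by blast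
  let ?ts = "[input_at x (length (bits x)), word_tape (tag_word k @ interleave (bits x) y)]"
  have "(step (guess_machine k) A)\<^sup>*\<^sup>* (init (guess_machine k) x) (k + 2, ?ts)"
    using guess_machine_copy[OF y(1), of "length (bits x)" k A] y(1) by simp
  moreover have "step (guess_machine k) A (k + 2, ?ts) (k + 4, ?ts)"
    unfolding guess_machine_def
    by (intro step_query_machineI[where as = "[(Blank, Stay), (Blank, Stay)]"])
      (auto simp: guess_prog_def act_input_at)
  moreover have "step (guess_machine k) A (k + 4, ?ts) (k + 5, ?ts)"
    using step.query[of "guess_machine k" A ?ts] y(2)
    by (simp add: guess_machine_def nat_of_bits_tag_word)
  ultimately have "(step (guess_machine k) A)\<^sup>*\<^sup>* (init (guess_machine k) x) (k + 5, ?ts)"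
    by (meson rtranclp.rtrancl_into_rtrancl)
  moreover have "halted (guess_machine k) A (k + 5, ?ts)"
    unfolding guess_machine_def by (rule halted_query_machine) simp
  ultimately show "accepts (guess_machine k) A x"
    unfolding accepts_def reaches_def by (intro exI[of _ "(k + 5, ?ts)"]) (simp add: guess_machine_def)
qed

subsection \<open>Exponential padding\<close>

text \<open>The work tape holds a left marker \<open>Aux (K + 1)\<close> followed by digits. A single rule (increment a
  digit and move right, or reset the full digit \<open>Aux K\<close> and move left; also move left at a blank)
  makes the head traverse the complete \<open>K\<close>-ary tree of depth the number of digits and
  then leave to the left. \<open>traversal K m\<close> is the duration for \<open>m\<close> digits. The head enters the tree
  from the right end, so the traversals for all numbers of digits up to \<open>n\<close> are performed one
  after the other. A bit is appended to the query tape in every step.\<close>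

fun traversal :: "nat \<Rightarrow> nat \<Rightarrow> nat" where
  "traversal K 0 = 1"
| "traversal K (Suc m) = K * (1 + traversal K m) + 1"

definition padding :: "nat \<Rightarrow> nat \<Rightarrow> nat" where
  "padding K n = (\<Sum>i\<le>n. traversal K i)"

lemma traversal_pos: "0 < traversal K m"
  by (cases m) auto

lemma power_le_padding: "K ^ n \<le> padding K n"
proof -
  have "K ^ n \<le> traversal K n"
    by (induction n) (auto simp: algebra_simps intro!: le_SucI trans_le_add2)
  also have "\<dots> \<le> padding K n" unfolding padding_def by (rule member_le_sum) auto
  finally show ?thesis .
qed

lemma strict_mono_padding: "m < n \<Longrightarrow> padding K m < padding K n"
  by (rule strict_monoD[of "padding K"])
    (auto simp: strict_mono_Suc_iff padding_def traversal_pos)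

lemma padding_le: "padding K n \<le> 2 ^ n * (K + 2) ^ Suc n"
proof -
  \<comment> \<open>Adding \<open>1\<close> to the traversal time turns its recursion into
    multiplication by \<open>K\<close> plus \<open>2\<close>.\<close>
  have t: "traversal K m + 1 \<le> (K + 2) ^ Suc m" for m
  proof (induction m)
    case (Suc m)
    have "traversal K (Suc m) + 1 = K * (traversal K m + 1) + 2" by simp
    also have "\<dots> \<le> K * (K + 2) ^ Suc m + 2 * (K + 2) ^ Suc m"
      using Suc by (intro add_mono mult_le_mono) (auto simp del: power_Suc)
    finally show ?case by (simp add: algebra_simps)
  qed simp
  have "padding K n \<le> (\<Sum>i\<le>n. (K + 2) ^ Suc n)"
    unfolding padding_def
  proof (rule sum_mono)
    fix i assume "i \<in> {..n}"
    then have "(K + 2) ^ Suc i \<le> (K + 2) ^ Suc n" by (intro power_increasing) auto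
    then show "traversal K i \<le> (K + 2) ^ Suc n" using t[of i] by linarith
  qed
  also have "\<dots> = Suc n * (K + 2) ^ Suc n" by simp
  also have "\<dots> \<le> 2 ^ n * (K + 2) ^ Suc n"
    by (intro mult_right_mono) (simp_all add: Suc_leI)
  finally show ?thesis .
qed

text \<open>State \<open>k + 1\<close> sets the marker and \<open>k + 2\<close> one digit per input
  bit. The traversal takes place in state \<open>k + 3\<close>; meeting the marker there means that
  the padding is complete.\<close>

definition pad_prog :: "nat \<Rightarrow> nat \<Rightarrow> nat \<Rightarrow> symb list \<Rightarrow> nat \<times> (symb \<times> dir) list" where
  "pad_prog K k q rs =
    (if q \<le> k then (q + 1, [(rs ! 0, Stay), (Bit True, Rgt), (rs ! 2, Stay)])
     else if q = k + 1 then (k + 2, [(rs ! 0, Stay), (Bit False, Rgt), (Aux (K + 1), Rgt)])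
     else if q = k + 2 then
       (case rs ! 0 of Bit b \<Rightarrow> (k + 2, [(rs ! 0, Rgt), (Bit b, Rgt), (Aux 0, Rgt)])
        | _ \<Rightarrow> (k + 3, [(rs ! 0, Stay), (rs ! 1, Stay), (rs ! 2, Stay)]))
     else
       (case rs ! 2 of
          Aux d \<Rightarrow>
            (if d < K then (k + 3, [(rs ! 0, Stay), (Bit False, Rgt), (Aux (d + 1), Rgt)])
             else if d = K then (k + 3, [(rs ! 0, Stay), (Bit False, Rgt), (Aux 0, Lft)])
             else (k + 4, [(rs ! 0, Stay), (rs ! 1, Stay), (rs ! 2, Stay)]))
        | _ \<Rightarrow> (k + 3, [(rs ! 0, Stay), (Bit False, Rgt), (rs ! 2, Lft)])))"

definition pad_machine :: "nat \<Rightarrow> nat \<Rightarrow> machine" where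
  "pad_machine K k = query_machine 3 (K + 1) k (\<lambda>q rs. {pad_prog K k q rs})"

lemma oracle_machine_pad_machine: "oracle_machine (pad_machine K k)"
  unfolding pad_machine_def
  by (rule oracle_machine_query_machine) (auto simp: pad_prog_def split: symb.splits if_splits)

lemma deterministic_pad_machine: "deterministic (pad_machine K k)"
  unfolding pad_machine_def deterministic_def query_machine_simps singleton_iff by (metis prod.inject)

lemma step_pad_machineI:
  assumes "q < k + 4" "(q', [a0, a1, a2]) = pad_prog K k q [read T0, read T1, read T2]"
    "read T0 \<in> symbols (K + 1)" "read T1 \<in> symbols (K + 1)" "read T2 \<in> symbols (K + 1)"
    "T0' = act a0 T0" "T1' = act a1 T1" "T2' = act a2 T2"
  shows "step (pad_machine K k) A (q, [T0, T1, T2]) (q', [T0', T1', T2'])"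
  unfolding pad_machine_def
  by (rule step_query_machineI[where as = "[a0, a1, a2]"]) (use assms in auto)

lemma relpowp_trans: "(R ^^ m) x y \<Longrightarrow> (R ^^ n) y z \<Longrightarrow> (R ^^ (m + n)) x z"
  by (auto simp: relpowp_add)

text \<open>Induction on the number of digits: the leading digit is incremented \<open>K\<close>
  times, each time followed by a traversal of the other digits, and is then reset. The tape is
  restored, so that traversals can be repeated.\<close>

lemma pad_traversal:
  assumes T0: "read T0 \<in> symbols (K + 1)"
  shows "\<lbrakk>0 < h; \<And>i. h \<le> i \<Longrightarrow> i < h + m \<Longrightarrow> g i = Aux 0; g (h + m) = Blank\<rbrakk> \<Longrightarrow>
    (step (pad_machine K k) A ^^ traversal K m) (k + 3, [T0, word_tape w, (g, h)])
      (k + 3, [T0, word_tape (w @ replicate (traversal K m) False), (g, h - 1)])"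
proof (induction m arbitrary: h g w)
  case 0
  have "step (pad_machine K k) A (k + 3, [T0, word_tape w, (g, h)])
      (k + 3, [T0, word_tape (w @ [False]), (g, h - 1)])"
    by (rule step_pad_machineI[where ?a0.0 = "(read T0, Stay)" and ?a1.0 = "(Bit False, Rgt)"
          and ?a2.0 = "(Blank, Lft)"]) (use 0 T0 in \<open>auto simp: pad_prog_def\<close>)
  then show ?case by (simp add: eq_OO)
next
  case (Suc m)
  note IH = Suc.IH and prems = Suc.prems
  \<comment> \<open>Here \<open>j\<close> increments of the leading digit remain. The outer
    hypothesis is applied to tapes with this digit changed, hence its generality in
    \<open>g\<close>.\<close>
  have digit: "j \<le> K \<Longrightarrow> (step (pad_machine K k) A ^^ (j * (1 + traversal K m) + 1))
      (k + 3, [T0, word_tape w, (g(h := Aux (K - j)), h)])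
      (k + 3, [T0, word_tape (w @ replicate (j * (1 + traversal K m) + 1) False), (g, h - 1)])" for j w
  proof (induction j arbitrary: w)
    case 0
    have "g(h := Aux 0) = g" using Suc.prems(2)[of h] by auto
    then have "step (pad_machine K k) A (k + 3, [T0, word_tape w, (g(h := Aux K), h)])
        (k + 3, [T0, word_tape (w @ [False]), (g, h - 1)])"
      by (intro step_pad_machineI[where ?a0.0 = "(read T0, Stay)" and ?a1.0 = "(Bit False, Rgt)"
            and ?a2.0 = "(Aux 0, Lft)"]) (use T0 in \<open>auto simp: pad_prog_def\<close>)
    then show ?case by (simp add: eq_OO fun_upd_def)
  next
    case (Suc j)
    let ?g = "g(h := Aux (K - j))" and ?w = "w @ [False]"
    let ?w' = "?w @ replicate (traversal K m) False"
    have r1: "step (pad_machine K k) A (k + 3, [T0, word_tape w, (g(h := Aux (K - Suc j)), h)])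
        (k + 3, [T0, word_tape ?w, (?g, Suc h)])"
      by (rule step_pad_machineI[where ?a0.0 = "(read T0, Stay)" and ?a1.0 = "(Bit False, Rgt)"
            and ?a2.0 = "(Aux (K - j), Rgt)"])
        (use T0 Suc.prems in \<open>auto simp: pad_prog_def Suc_diff_Suc\<close>)
    have r2: "(step (pad_machine K k) A ^^ traversal K m) (k + 3, [T0, word_tape ?w, (?g, Suc h)])
        (k + 3, [T0, word_tape ?w', (?g, Suc h - 1)])"
      by (rule IH) (use prems(2) prems(3) in auto)
    have r3: "(step (pad_machine K k) A ^^ (j * (1 + traversal K m) + 1))
        (k + 3, [T0, word_tape ?w', (?g, h)])
        (k + 3, [T0, word_tape (?w' @ replicate (j * (1 + traversal K m) + 1) False), (g, h - 1)])"
      by (rule Suc.IH) (use Suc.prems in simp)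
    have e: "Suc j * (1 + traversal K m) + 1 = Suc (traversal K m + (j * (1 + traversal K m) + 1))"
      by simp
    have w: "w @ replicate (Suc j * (1 + traversal K m) + 1) False
        = ?w' @ replicate (j * (1 + traversal K m) + 1) False"
      unfolding e by (simp add: replicate_add replicate_append_same)
    show ?case unfolding w unfolding e
      by (rule relpowp_Suc_I2[OF r1 relpowp_trans[OF r2[unfolded diff_Suc_1] r3]])
  qed
  have "g(h := Aux 0) = g" using Suc.prems(2)[of h] by auto
  then show ?case using digit[of K w] by simp
qed

definition work_tape :: "nat \<Rightarrow> nat \<Rightarrow> nat \<Rightarrow> symb" where
  "work_tape K n i = (if i = 0 then Aux (K + 1) else if i \<le> n then Aux 0 else Blank)"

text \<open>A traversal leaves the head one cell further left, at the start of a block with one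
  digit more; after the last one it stands on the marker in cell \<open>0\<close> if
  \<open>m = n\<close>.\<close>

lemma pad_chain:
  assumes T0: "read T0 \<in> symbols (K + 1)"
  shows "m \<le> n \<Longrightarrow>
    (step (pad_machine K k) A ^^ padding K m) (k + 3, [T0, word_tape w, (work_tape K n, Suc n)])
      (k + 3, [T0, word_tape (w @ replicate (padding K m) False), (work_tape K n, n - m)])"
proof (induction m)
  case 0
  have "work_tape K n (Suc n) = Blank" by (simp add: work_tape_def)
  then show ?case using pad_traversal[OF T0, of "Suc n" 0 "work_tape K n" k A w]
    by (simp add: padding_def)
next
  case (Suc m)
  let ?w = "w @ replicate (padding K m) False"
  have r1: "(step (pad_machine K k) A ^^ padding K m) (k + 3, [T0, word_tape w, (work_tape K n, Suc n)])
      (k + 3, [T0, word_tape ?w, (work_tape K n, n - m)])"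
    using Suc by simp
  have r2: "(step (pad_machine K k) A ^^ traversal K (Suc m)) (k + 3, [T0, word_tape ?w, (work_tape K n, n - m)])
      (k + 3, [T0, word_tape (?w @ replicate (traversal K (Suc m)) False), (work_tape K n, n - m - 1)])"
    by (rule pad_traversal[OF T0]) (use Suc.prems in \<open>auto simp: work_tape_def\<close>)
  have e: "padding K (Suc m) = padding K m + traversal K (Suc m)" by (simp add: padding_def)
  have h: "n - Suc m = n - m - 1" by simp
  show ?case unfolding e h replicate_add append_assoc[symmetric] by (rule relpowp_trans[OF r1 r2])
qed

lemma init_pad_machine:
  "init (pad_machine K k) x = (0, [input_at x 0, word_tape [], blank_tape])"
  by (simp add: init_def pad_machine_def input_at_0 word_tape_Nil numeral_2_eq_2)

lemma read_input_at_symbols: "read (input_at x h) \<in> symbols K"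
  by simp

lemma pad_prefix:
  "i \<le> k + 1 \<Longrightarrow> (step (pad_machine K k) A ^^ i) (init (pad_machine K k) x)
    (i, [input_at x 0, word_tape (replicate i True), blank_tape])"
proof (induction i)
  case (Suc i)
  have "step (pad_machine K k) A (i, [input_at x 0, word_tape (replicate i True), blank_tape])
      (Suc i, [input_at x 0, word_tape (replicate (Suc i) True), blank_tape])"
    by (rule step_pad_machineI[where ?a0.0 = "(read (input_at x 0), Stay)"
          and ?a1.0 = "(Bit True, Rgt)" and ?a2.0 = "(Blank, Stay)"])
      (use Suc.prems in \<open>auto simp: pad_prog_def act_input_at blank_tape_def replicate_append_same\<close>)
  then show ?case using Suc by (meson Suc_leD relpowp_Suc_I)
qed (simp add: init_pad_machine)

lemma pad_copy:
  "h \<le> length (bits x) \<Longrightarrow> (step (pad_machine K k) A ^^ (k + 2 + h)) (init (pad_machine K k) x)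
    (k + 2, [input_at x h, word_tape (tag_word k @ take h (bits x)), (work_tape K h, Suc h)])"
proof (induction h)
  case 0
  have "step (pad_machine K k) A (k + 1, [input_at x 0, word_tape (replicate (k + 1) True), blank_tape])
      (k + 2, [input_at x 0, word_tape (tag_word k), (work_tape K 0, 1)])"
    by (rule step_pad_machineI[where ?a0.0 = "(read (input_at x 0), Stay)"
          and ?a1.0 = "(Bit False, Rgt)" and ?a2.0 = "(Aux (K + 1), Rgt)"])
      (auto simp: pad_prog_def act_input_at blank_tape_def tag_word_def work_tape_def fun_eq_iff)
  then show ?case using relpowp_Suc_I[OF pad_prefix[of "k + 1" k K A x]] by simp
next
  case (Suc h)
  have "step (pad_machine K k) A
      (k + 2, [input_at x h, word_tape (tag_word k @ take h (bits x)), (work_tape K h, Suc h)])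
      (k + 2, [input_at x (Suc h), word_tape (tag_word k @ take (Suc h) (bits x)), (work_tape K (Suc h), Suc (Suc h))])"
    by (rule step_pad_machineI[where ?a0.0 = "(read (input_at x h), Rgt)"
          and ?a1.0 = "(Bit (bits x ! h), Rgt)" and ?a2.0 = "(Aux 0, Rgt)"])
      (use Suc.prems in \<open>auto simp: pad_prog_def act_input_at take_Suc_conv_app_nth work_tape_def fun_eq_iff\<close>)
  then show ?case using relpowp_Suc_I[OF Suc.IH] Suc.prems by simp
qed

lemma pad_machine_run:
  fixes K k x A
  defines "n \<equiv> length (bits x)"
  defines "q \<equiv> tagged k (bits x @ replicate (padding K n) False)"
  shows "\<exists>ts. (step (pad_machine K k) A ^^ (k + n + padding K n + 5)) (init (pad_machine K k) x)
    (if q \<in> A then k + 5 else k + 6, ts)"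
proof -
  let ?T0 = "input_at x n" and ?w = "tag_word k @ bits x"
  let ?w' = "?w @ replicate (padding K n) False"
  let ?ts = "[?T0, word_tape ?w', (work_tape K n, 0)]"
  have r1: "(step (pad_machine K k) A ^^ (k + 2 + n)) (init (pad_machine K k) x)
      (k + 2, [?T0, word_tape ?w, (work_tape K n, Suc n)])"
    using pad_copy[of n x k K A] by (simp add: n_def)
  have r2: "step (pad_machine K k) A (k + 2, [?T0, word_tape ?w, (work_tape K n, Suc n)])
      (k + 3, [?T0, word_tape ?w, (work_tape K n, Suc n)])"
    by (rule step_pad_machineI[where ?a0.0 = "(Blank, Stay)"
          and ?a1.0 = "(Blank, Stay)" and ?a2.0 = "(Blank, Stay)"])
      (auto simp: pad_prog_def act_input_at work_tape_def n_def)
  have r3: "(step (pad_machine K k) A ^^ padding K n)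
      (k + 3, [?T0, word_tape ?w, (work_tape K n, Suc n)]) (k + 3, ?ts)"
    using pad_chain[of ?T0 K n n k A ?w] read_input_at_symbols by simp
  have r4: "step (pad_machine K k) A (k + 3, ?ts) (k + 4, ?ts)"
    by (rule step_pad_machineI[where ?a0.0 = "(Blank, Stay)"
          and ?a1.0 = "(Blank, Stay)" and ?a2.0 = "(Aux (K + 1), Stay)"])
      (auto simp: pad_prog_def act_input_at work_tape_def n_def)
  have num: "tape_number (?ts ! 1) = q"
    using nat_of_bits_tag_word[of k "bits x @ replicate (padding K n) False"] by (simp add: q_def)
  have states: "query_state (pad_machine K k) = k + 4" "yes_state (pad_machine K k) = k + 5"
    "no_state (pad_machine K k) = k + 6" by (simp_all add: pad_machine_def)
  have r5: "step (pad_machine K k) A (k + 4, ?ts) (if q \<in> A then k + 5 else k + 6, ?ts)"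
    using step.query[of "pad_machine K k" A ?ts] by (simp only: states num)
  have "(step (pad_machine K k) A ^^ (Suc (k + 2 + n) + padding K n)) (init (pad_machine K k) x) (k + 3, ?ts)"
    by (rule relpowp_trans[OF relpowp_Suc_I[OF r1 r2] r3])
  note run = relpowp_Suc_I[OF relpowp_Suc_I[OF this r4] r5]
  \<comment> \<open>The tag takes \<open>k + 2\<close> steps, the copy \<open>n\<close>, the padding
    \<open>padding K n\<close>; entering and leaving the padding phase and the query take one step
    each.\<close>
  have e: "k + n + padding K n + 5 = Suc (Suc (Suc (k + 2 + n) + padding K n))" by simp
  show ?thesis unfolding e using run by blast
qed

lemma pad_machine_halting:
  "q \<in> {k + 5, k + 6} \<Longrightarrow> halted (pad_machine K k) A (q, ts)"
  unfolding pad_machine_def by (rule halted_query_machine) auto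

lemma accepts_pad_machine:
  "accepts (pad_machine K k) A x \<longleftrightarrow>
    tagged k (bits x @ replicate (padding K (length (bits x))) False) \<in> A"
  (is "_ \<longleftrightarrow> ?q \<in> A")
proof -
  obtain N ts where r: "(step (pad_machine K k) A ^^ N) (init (pad_machine K k) x)
      (if ?q \<in> A then k + 5 else k + 6, ts)" using pad_machine_run by blast
  have h: "halted (pad_machine K k) A (if ?q \<in> A then k + 5 else k + 6, ts)"
    by (rule pad_machine_halting) auto
  have acc: "accept_state (pad_machine K k) = k + 5" by (simp add: pad_machine_def)
  show ?thesis
  proof
    assume "accepts (pad_machine K k) A x"
    then obtain N' c where c: "(step (pad_machine K k) A ^^ N') (init (pad_machine K k) x) c"
      "halted (pad_machine K k) A c" "fst c = k + 5"
      unfolding accepts_def reaches_def acc by (meson rtranclp_imp_relpowp)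
    have "c = (if ?q \<in> A then k + 5 else k + 6, ts)"
      by (rule deterministic_halted_unique[OF deterministic_pad_machine c(1,2) r h])
    then show "?q \<in> A" using c(3) by (auto split: if_splits)
  next
    assume "?q \<in> A"
    then show "accepts (pad_machine K k) A x"
      using relpowp_imp_rtranclp[OF r] h unfolding accepts_def reaches_def acc by auto
  qed
qed

lemma pad_machine_time:
  "\<exists>c. runs_in_time (pad_machine K k) A (\<lambda>n. 2 ^ (c * n + c))"
proof -
  \<comment> \<open>The dominant term has exponent \<open>k + 5 + n + (K + 1) * (n + 1)\<close>,
    where \<open>n\<close> is the input length; there is room for one more factor \<open>2\<close>,
    as two terms are added.\<close>
  let ?c = "k + K + 9"
  have "j \<le> 2 ^ (?c * length (bits x) + ?c)"
    if "(step (pad_machine K k) A ^^ j) (init (pad_machine K k) x) c" for x j c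
  proof -
    let ?n = "length (bits x)"
    obtain ts where r: "(step (pad_machine K k) A ^^ (k + ?n + padding K ?n + 5)) (init (pad_machine K k) x)
       (if tagged k (bits x @ replicate (padding K ?n) False) \<in> A then k + 5 else k + 6, ts)"
      using pad_machine_run by blast
    have "j \<le> k + ?n + padding K ?n + 5"
      using deterministic_run[OF deterministic_pad_machine r pad_machine_halting that] by auto
    also have "k + 5 < 2 ^ (k + 5)" by simp
    then have "k + ?n + padding K ?n + 5 \<le> 2 ^ (k + 5) + 2 ^ ?n + padding K ?n"
      using less_exp[of ?n] by linarith
    also have "\<dots> \<le> 2 ^ (k + 5) * 2 ^ ?n * 2 + 2 ^ (k + 5) * (2 ^ ?n * 2 ^ (Suc K * Suc ?n))"
    proof (rule add_mono)
      have "(K + 2) ^ Suc ?n \<le> (2 ^ Suc K) ^ Suc ?n"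
        by (rule power_mono) (use less_exp[of "Suc K"] in linarith, simp)
      also have "\<dots> = 2 ^ (Suc K * Suc ?n)" by (simp only: power_mult)
      finally have "padding K ?n \<le> 1 * (2 ^ ?n * 2 ^ (Suc K * Suc ?n))"
        using padding_le[of K ?n] by (simp only: mult_1) (meson le_trans mult_le_mono2)
      also have "\<dots> \<le> 2 ^ (k + 5) * (2 ^ ?n * 2 ^ (Suc K * Suc ?n))"
        by (rule mult_right_mono) auto
      finally show "padding K ?n \<le> 2 ^ (k + 5) * (2 ^ ?n * 2 ^ (Suc K * Suc ?n))" .
      have "a + b \<le> a * b * 2" if "1 \<le> a" "1 \<le> b" for a b :: nat
      proof -
        have "a * 1 \<le> a * b" "1 * b \<le> a * b" using that by (intro mult_le_mono; simp)+
        then show ?thesis by linarith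
      qed
      then show "2 ^ (k + 5) + 2 ^ ?n \<le> 2 ^ (k + 5) * 2 ^ ?n * (2::nat)" by simp
    qed
    also have "\<dots> \<le> 2 ^ (?c * ?n + ?c - 1) + 2 ^ (?c * ?n + ?c - 1)"
    proof (rule add_mono)
      have "2 ^ (k + 5) * 2 ^ ?n * (2::nat) = 2 ^ (k + 5 + ?n + 1)" by (simp add: power_add)
      also have "\<dots> \<le> 2 ^ (?c * ?n + ?c - 1)"
        by (intro power_increasing) (auto simp: algebra_simps)
      finally show "2 ^ (k + 5) * 2 ^ ?n * (2::nat) \<le> 2 ^ (?c * ?n + ?c - 1)" .
      have "2 ^ (k + 5) * (2 ^ ?n * 2 ^ (Suc K * Suc ?n)) = (2::nat) ^ (k + 5 + (?n + Suc K * Suc ?n))"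
        by (simp only: power_add)
      also have "\<dots> \<le> 2 ^ (?c * ?n + ?c - 1)"
        by (intro power_increasing) (auto simp: algebra_simps)
      finally show "2 ^ (k + 5) * (2 ^ ?n * 2 ^ (Suc K * Suc ?n)) \<le> (2::nat) ^ (?c * ?n + ?c - 1)" .
    qed
    also have "\<dots> = 2 ^ Suc (?c * ?n + ?c - 1)" by (simp only: power_Suc mult_2)
    also have "Suc (?c * ?n + ?c - 1) = ?c * ?n + ?c" by simp
    finally show ?thesis .
  qed
  then show ?thesis unfolding runs_in_time_def by blast
qed

section \<open>The oracle\<close>

instance symb :: countable
  by countable_datatype

instance dir :: countable
  by countable_datatype

lemma countable_oracle_machines: "countable {M. oracle_machine M}"
proof -
  let ?f = "\<lambda>M :: machine. (num_tapes M, instrs M, start_state M, accept_state M, query_state M,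
    yes_state M, no_state M)"
  have "inj ?f" by (auto simp: inj_def)
  moreover have "?f ` {M. oracle_machine M} \<subseteq> UNIV \<times> {I. finite I} \<times> UNIV"
    by (auto simp: oracle_machine_def)
  moreover have "countable (UNIV \<times> {I :: instr set. finite I} \<times> (UNIV :: (nat \<times> nat \<times> nat \<times> nat \<times> nat) set)
      :: (nat \<times> instr set \<times> nat \<times> nat \<times> nat \<times> nat \<times> nat) set)"
    by (intro countable_SIGMA countable_Collect_finite) auto
  ultimately show ?thesis
    by (meson countable_image_inj_on countable_subset inj_on_subset subset_UNIV)
qed

definition nth_machine :: "nat \<Rightarrow> machine" where
  "nth_machine = from_nat_into {M. oracle_machine M}"

lemma oracle_machine_nth_machine: "oracle_machine (nth_machine e)"
  unfolding nth_machine_def using from_nat_into[of "{M. oracle_machine M}" e]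
    oracle_machine_guess_machine[of 0] by blast

lemma nth_machine_surj:
  assumes "oracle_machine M"
  obtains e where "nth_machine e = M"
  using from_nat_into_surj[OF countable_oracle_machines] assms unfolding nth_machine_def by blast

text \<open>Odd tags mark coding numbers, even tags witnesses. The parameter \<open>r\<close> sets
  the growth of the padding, so that every exponential time bound is met by some \<open>r\<close>;
  the base is at least \<open>2\<close>, which makes coding numbers sparse.\<close>

definition coding :: "nat \<Rightarrow> nat \<Rightarrow> nat \<Rightarrow> nat" where
  "coding e r x = tagged (2 * prod_encode (e, r) + 1)
     (bits x @ replicate (padding (r + 2) (length (bits x))) False)"

definition coding_numbers :: "nat set" where
  "coding_numbers = {coding e r x | e r x. True}"

definition witness :: "nat \<Rightarrow> bool \<Rightarrow> nat \<Rightarrow> bool list \<Rightarrow> nat" where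
  "witness a s x y = tagged (4 * a + 2 * of_bool s) (interleave (bits x) y)"

lemma bits_inject: "bits x = bits y \<longleftrightarrow> x = y"
  by (metis nat_of_bits_bits)

text \<open>Nothing separates \<open>bits x\<close> from the padding, but the total length is
  strictly increasing in the length of \<open>x\<close> and thus determines it.\<close>

lemma coding_inject: "coding e r x = coding e' r' x' \<longleftrightarrow> e = e' \<and> r = r' \<and> x = x'"
proof
  assume *: "coding e r x = coding e' r' x'"
  then have er: "e = e'" "r = r'" by (auto simp: coding_def)
  let ?n = "length (bits x)" and ?n' = "length (bits x')"
  have w: "bits x @ replicate (padding (r + 2) ?n) False = bits x' @ replicate (padding (r + 2) ?n') False"
    using * er by (simp add: coding_def)
  from arg_cong[OF w, of length] have "?n + padding (r + 2) ?n = ?n' + padding (r + 2) ?n'" by simp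
  then have "?n = ?n'"
    using strict_mono_padding[of ?n ?n' "r + 2"] strict_mono_padding[of ?n' ?n "r + 2"]
    by (cases ?n ?n' rule: linorder_cases) auto
  then show "e = e' \<and> r = r' \<and> x = x'" using w er by (simp add: bits_inject)
qed simp

lemma witness_inject:
  assumes "length y = length (bits x)" "length y' = length (bits x')"
  shows "witness a s x y = witness a' s' x' y' \<longleftrightarrow> a = a' \<and> s = s' \<and> x = x' \<and> y = y'"
proof
  assume "witness a s x y = witness a' s' x' y'"
  then have *: "4 * a + 2 * of_bool s = 4 * a' + 2 * of_bool s'"
    "interleave (bits x) y = interleave (bits x') y'" by (simp_all add: witness_def)
  from *(1) have "a = a' \<and> s = s'" by (cases s; cases s'; simp; presburger)
  then show "a = a' \<and> s = s' \<and> x = x' \<and> y = y'"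
    using interleave_eqD[OF _ _ *(2)] assms by (auto simp: bits_inject)
qed simp

lemma witness_not_coding: "witness a s x y \<notin> coding_numbers"
proof
  assume "witness a s x y \<in> coding_numbers"
  then obtain e r where "4 * a + 2 * of_bool s = 2 * prod_encode (e, r) + 1"
    unfolding coding_numbers_def witness_def coding_def by auto
  then show False by (cases s; simp; presburger)
qed

lemma length_bits_coding:
  "length (bits (coding e r x)) = 2 * prod_encode (e, r) + 3 + length (bits x) +
    padding (r + 2) (length (bits x))"
  by (simp add: coding_def length_bits_tagged)

lemma less_length_bits_coding: "x < length (bits (coding e r x))"
proof -
  have "x < 2 ^ length (bits x)" by (rule less_two_power_length_bits)
  also have "\<dots> \<le> (r + 2) ^ length (bits x)" by (rule power_mono) auto
  also have "\<dots> \<le> padding (r + 2) (length (bits x))" by (rule power_le_padding)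
  finally show ?thesis by (simp add: length_bits_coding)
qed

text \<open>A run whose length is below that of the query cannot ask the query itself.\<close>

definition budget :: "nat \<Rightarrow> nat" where
  "budget q = length (bits q) - 1"

lemma coding_ge: "2 ^ budget (coding e r x) \<le> coding e r x"
  unfolding budget_def
  using tagged_ge[of "2 * prod_encode (e, r) + 1" "bits x @ replicate (padding (r + 2) (length (bits x))) False"]
  by (simp add: coding_def length_bits_tagged)

text \<open>The length exceeds \<open>prod_encode (e, r)\<close> because of the unary tag and the
  number \<open>x\<close> itself because of the padding, which leaves \<open>L\<close> choices for
  each.\<close>

lemma card_coding_numbers: "finite (coding_numbers \<inter> {..<2 ^ L}) \<and> card (coding_numbers \<inter> {..<2 ^ L}) \<le> L * L"
proof -
  let ?f = "\<lambda>(i, x). coding (fst (prod_decode i)) (snd (prod_decode i)) x"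
  have sub: "coding_numbers \<inter> {..<2 ^ L} \<subseteq> ?f ` ({..<L} \<times> {..<L})"
  proof
    fix q assume "q \<in> coding_numbers \<inter> {..<2 ^ L}"
    then obtain e r x where q: "q = coding e r x" "q < 2 ^ L" unfolding coding_numbers_def by auto
    have "length (bits q) \<le> L" using q(2) by (rule length_bits_le)
    then have "prod_encode (e, r) < L" "x < L"
      using less_length_bits_coding[of x e r] length_bits_coding[of e r x] q(1) by auto
    then show "q \<in> ?f ` ({..<L} \<times> {..<L})"
      using q(1) by (intro image_eqI[of _ _ "(prod_encode (e, r), x)"]) auto
  qed
  have "card (?f ` ({..<L} \<times> {..<L})) \<le> L * L"
    using card_image_le[of "{..<L} \<times> {..<L}" ?f] by simp
  then show ?thesis using sub
    by (meson card_mono finite_SigmaI finite_imageI finite_lessThan finite_subset le_trans)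
qed

text \<open>Membership is settled number by number, so that primitive recursion suffices: the
  computation coded by \<open>q\<close> is run relative to the part already built.\<close>

primrec oracle_below :: "nat set \<Rightarrow> nat \<Rightarrow> nat set" where
  "oracle_below W 0 = {}"
| "oracle_below W (Suc q) = oracle_below W q \<union>
     (if (if q \<in> coding_numbers
          then \<exists>e r x. q = coding e r x \<and> accepts_within (nth_machine e) (oracle_below W q) x (budget q)
          else q \<in> W) then {q} else {})"

definition oracle_of :: "nat set \<Rightarrow> nat set" where
  "oracle_of W = (\<Union>q. oracle_below W q)"

lemma oracle_below_less: "u \<in> oracle_below W q \<Longrightarrow> u < q"
  by (induction q) (auto split: if_splits)

lemma mem_oracle_below: "u \<in> oracle_below W q \<longleftrightarrow> u < q \<and> u \<in> oracle_of W"
proof -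
  have mono: "m \<le> n \<Longrightarrow> oracle_below W m \<subseteq> oracle_below W n" for m n
    by (rule lift_Suc_mono_le) auto
  have down: "m \<le> n \<Longrightarrow> u < m \<Longrightarrow> u \<in> oracle_below W n \<Longrightarrow> u \<in> oracle_below W m" for m n
    by (induction n rule: dec_induct) (auto split: if_splits)
  show ?thesis
  proof
    assume "u < q \<and> u \<in> oracle_of W"
    then obtain p where "u < q" "u \<in> oracle_below W p" unfolding oracle_of_def by blast
    then show "u \<in> oracle_below W q" using mono[of p q] down[of q p] by (cases "p \<le> q") auto
  qed (auto simp: oracle_of_def oracle_below_less)
qed

lemma mem_oracle_of:
  "u \<in> oracle_of W \<longleftrightarrow> (if u \<in> coding_numbers
     then \<exists>e r x. u = coding e r x \<and> accepts_within (nth_machine e) (oracle_below W u) x (budget u)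
     else u \<in> W)"
proof -
  have "u \<in> oracle_of W \<longleftrightarrow> u \<in> oracle_below W (Suc u)" by (simp add: mem_oracle_below del: oracle_below.simps)
  then show ?thesis using oracle_below_less[of u W u] by auto
qed

lemma noncoding_mem_oracle_of: "u \<notin> coding_numbers \<Longrightarrow> u \<in> oracle_of W \<longleftrightarrow> u \<in> W"
  by (simp add: mem_oracle_of)

lemma witness_mem_oracle_of: "witness a s x y \<in> oracle_of W \<longleftrightarrow> witness a s x y \<in> W"
  by (simp add: noncoding_mem_oracle_of witness_not_coding)

text \<open>The fixed point property. Within the budget, only numbers below the coding number are
  queried, and there the stage and the full oracle agree.\<close>

lemma coding_mem_oracle_of:
  "coding e r x \<in> oracle_of W \<longleftrightarrow>
    accepts_within (nth_machine e) (oracle_of W) x (budget (coding e r x))"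
proof -
  have "coding e r x \<in> coding_numbers" by (auto simp: coding_numbers_def)
  then have "coding e r x \<in> oracle_of W \<longleftrightarrow>
      accepts_within (nth_machine e) (oracle_below W (coding e r x)) x (budget (coding e r x))"
    by (auto simp: mem_oracle_of coding_inject)
  also have "\<dots> \<longleftrightarrow> accepts_within (nth_machine e) (oracle_of W) x (budget (coding e r x))"
  proof (rule accepts_within_cong[OF oracle_machine_nth_machine])
    fix u :: nat assume "u < 2 ^ budget (coding e r x)"
    then have "u < coding e r x" using coding_ge less_le_trans by blast
    then show "u \<in> oracle_below W (coding e r x) \<longleftrightarrow> u \<in> oracle_of W"
      by (simp add: mem_oracle_below)
  qed
  finally show ?thesis .
qed

text \<open>The coding part is determined by smaller numbers, so an initial segment of
  \<open>W\<close> settles the same segment of the oracle.\<close>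

lemma oracle_of_cong:
  assumes "\<And>u. u < B \<Longrightarrow> u \<in> W \<longleftrightarrow> u \<in> W'"
  shows "u < B \<Longrightarrow> u \<in> oracle_of W \<longleftrightarrow> u \<in> oracle_of W'"
proof -
  have "q \<le> B \<Longrightarrow> oracle_below W q = oracle_below W' q" for q
    by (induction q) (use assms in \<open>auto simp: Suc_le_eq\<close>)
  from this[of B] show "u < B \<Longrightarrow> u \<in> oracle_of W \<longleftrightarrow> u \<in> oracle_of W'"
    by (metis mem_oracle_below order_refl)
qed

section \<open>Equality of \<open>E\<close> and \<open>NE\<close> relative to the oracle\<close>

lemma E_subset_NE: "E A \<subseteq> NE A"
  unfolding E_def NE_def DTIME_def NTIME_def by blast

lemma NE_subset_E: "NE (oracle_of W) \<subseteq> E (oracle_of W)"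
proof
  fix L assume "L \<in> NE (oracle_of W)"
  then obtain c M where M: "L = {x. accepts M (oracle_of W) x}" "oracle_machine M"
    "runs_in_time M (oracle_of W) (\<lambda>n. 2 ^ (c * n + c))"
    unfolding NE_def NTIME_def by blast
  obtain e where e: "nth_machine e = M" using nth_machine_surj[OF M(2)] .
  \<comment> \<open>For inputs of positive length \<open>n\<close>, \<open>2 ^ (c * n + c)\<close>
    is at most \<open>r ^ n\<close>.\<close>
  define r :: nat where "r = 2 ^ (2 * c)"
  \<comment> \<open>With these parameters the query asked is \<open>coding e r x\<close>.\<close>
  let ?D = "pad_machine (r + 2) (2 * prod_encode (e, r) + 1)"
  have "accepts ?D (oracle_of W) x \<longleftrightarrow> x \<in> L" for x
  proof -
    let ?n = "length (bits x)"
    have "2 ^ (c * ?n + c) \<le> budget (coding e r x)"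
    proof (cases "?n = 0")
      \<comment> \<open>For the empty input the padding has length \<open>1\<close> whatever
        \<open>r\<close> is; the unary tag supplies the budget instead.\<close>
      case True
      have "(2::nat) ^ c \<le> r" unfolding r_def by (intro power_increasing) auto
      also have "r \<le> prod_encode (e, r)" by (rule le_prod_encode_2)
      finally show ?thesis using True by (simp add: budget_def length_bits_coding)
    next
      case False
      then have "c * 1 \<le> c * ?n" by (intro mult_le_mono2) (simp add: Suc_le_eq)
      then have "(2::nat) ^ (c * ?n + c) \<le> 2 ^ (2 * c * ?n)" by (intro power_increasing) auto
      also have "\<dots> = r ^ ?n" by (simp only: r_def power_mult)
      also have "\<dots> \<le> (r + 2) ^ ?n" by (rule power_mono) auto
      also have "\<dots> \<le> padding (r + 2) ?n" by (rule power_le_padding)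
      finally show ?thesis by (simp add: budget_def length_bits_coding)
    qed
    then have "coding e r x \<in> oracle_of W \<longleftrightarrow> accepts M (oracle_of W) x"
      using accepts_within_iff[OF M(3)] e by (simp add: coding_mem_oracle_of)
    then show ?thesis by (simp add: accepts_pad_machine M(1) coding_def)
  qed
  then have "L = {x. accepts ?D (oracle_of W) x}" by blast
  moreover obtain c' where "runs_in_time ?D (oracle_of W) (\<lambda>n. 2 ^ (c' * n + c'))"
    using pad_machine_time by blast
  ultimately show "L \<in> E (oracle_of W)"
    unfolding E_def DTIME_def using oracle_machine_pad_machine deterministic_pad_machine by blast
qed

section \<open>Diagonalization\<close>

text \<open>Few coding numbers lie below \<open>2 ^ L\<close>. Going through them in increasing order, each one that
  can still be made true is made true and is kept true by fixing the queries of one accepting run;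
  the others are false for every remaining choice of \<open>W\<close>.\<close>

lemma fix_coding_numbers:
  assumes "\<W> \<noteq> {}"
  shows "N \<le> 2 ^ L \<Longrightarrow> \<exists>W0\<in>\<W>. \<exists>D. finite D \<and> card D \<le> L * card (coding_numbers \<inter> {..<N}) \<and>
    (\<forall>W\<in>\<W>. (\<forall>u\<in>D. u \<in> W \<longleftrightarrow> u \<in> W0) \<longrightarrow>
       (\<forall>q\<in>coding_numbers \<inter> {..<N}. q \<in> oracle_of W \<longleftrightarrow> q \<in> oracle_of W0))"
proof (induction N)
  case 0
  obtain W0 where "W0 \<in> \<W>" using assms by blast
  then show ?case by (intro bexI[of _ W0] exI[of _ "{}"]) auto
next
  case (Suc N)
  then obtain W0 D where W0: "W0 \<in> \<W>" and D: "finite D" "card D \<le> L * card (coding_numbers \<inter> {..<N})"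
    and fixed: "\<And>W q. \<lbrakk>W \<in> \<W>; \<forall>u\<in>D. u \<in> W \<longleftrightarrow> u \<in> W0; q \<in> coding_numbers; q < N\<rbrakk>
      \<Longrightarrow> q \<in> oracle_of W \<longleftrightarrow> q \<in> oracle_of W0"
    by (metis (no_types, lifting) IntI Suc_leD lessThan_iff)
  have mono: "card (coding_numbers \<inter> {..<N}) \<le> card (coding_numbers \<inter> {..<Suc N})"
    by (rule card_mono) auto
  show ?case
  proof (cases "N \<in> coding_numbers \<and> (\<exists>W\<in>\<W>. (\<forall>u\<in>D. u \<in> W \<longleftrightarrow> u \<in> W0) \<and> N \<in> oracle_of W)")
    \<comment> \<open>Either \<open>N\<close> is no coding number, or no remaining choice makes it
      true; nothing more has to be fixed.\<close>
    case False
    have "q \<in> oracle_of W \<longleftrightarrow> q \<in> oracle_of W0"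
      if "W \<in> \<W>" "\<forall>u\<in>D. u \<in> W \<longleftrightarrow> u \<in> W0" "q \<in> coding_numbers \<inter> {..<Suc N}" for W q
    proof (cases "q = N")
      case True
      then have "q \<notin> oracle_of W" "q \<notin> oracle_of W0" using False that W0 by blast+
      then show ?thesis by simp
    next
      case False
      then show ?thesis using that by (intro fixed) auto
    qed
    moreover have "card D \<le> L * card (coding_numbers \<inter> {..<Suc N})"
      using D(2) mono by (meson le_trans mult_le_mono2)
    ultimately show ?thesis using W0 D(1) by blast
  next
    case True
    then obtain W1 where W1: "W1 \<in> \<W>" "\<forall>u\<in>D. u \<in> W1 \<longleftrightarrow> u \<in> W0" "N \<in> oracle_of W1" by blast
    obtain e r x where N: "N = coding e r x" using True unfolding coding_numbers_def by blast
    have "accepts_within (nth_machine e) (oracle_of W1) x (budget N)"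
      using W1(3) by (simp add: N coding_mem_oracle_of)
    from accepts_within_queries[OF oracle_machine_nth_machine this]
    obtain Q where Q: "finite Q" "card Q \<le> budget N" "Q \<subseteq> {..<2 ^ budget N}"
      "\<And>B. \<forall>u\<in>Q. u \<in> oracle_of W1 \<longleftrightarrow> u \<in> B \<Longrightarrow> accepts_within (nth_machine e) B x (budget N)"
      by blast
    have "Q \<subseteq> {..<N}" using Q(3) coding_ge[of e r x] N by auto
    \<comment> \<open>Each coding number made true costs at most \<open>L\<close> fixed
      values.\<close>
    have "budget N \<le> L" using length_bits_le[of N L] Suc.prems by (simp add: budget_def)
    have "card (D \<union> Q) \<le> L * card (coding_numbers \<inter> {..<Suc N})"
    proof -
      have "coding_numbers \<inter> {..<Suc N} = insert N (coding_numbers \<inter> {..<N})" using True by auto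
      then have "card (coding_numbers \<inter> {..<Suc N}) = Suc (card (coding_numbers \<inter> {..<N}))" by simp
      then show ?thesis using D(2) Q(2) \<open>budget N \<le> L\<close> card_Un_le[of D Q] by simp
    qed
    moreover have "q \<in> oracle_of W \<longleftrightarrow> q \<in> oracle_of W1"
      if W: "W \<in> \<W>" "\<forall>u\<in>D \<union> Q. u \<in> W \<longleftrightarrow> u \<in> W1" and q: "q \<in> coding_numbers \<inter> {..<Suc N}" for W q
    proof -
      have less: "p \<in> oracle_of W \<longleftrightarrow> p \<in> oracle_of W1" if "p \<in> coding_numbers" "p < N" for p
        using fixed[of W p] fixed[of W1 p] W W1 that by auto
      \<comment> \<open>All queries lie below \<open>N\<close>: those outside
        \<open>coding_numbers\<close> are fixed through \<open>Q\<close>, the others by the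
        induction hypothesis.\<close>
      have "u \<in> oracle_of W1 \<longleftrightarrow> u \<in> oracle_of W" if "u \<in> Q" for u
        using less[of u] W(2) that \<open>Q \<subseteq> {..<N}\<close>
        by (cases "u \<in> coding_numbers") (auto simp: noncoding_mem_oracle_of)
      then have "N \<in> oracle_of W" using Q(4)[of "oracle_of W"] by (simp add: N coding_mem_oracle_of)
      then show ?thesis using less[of q] q W1(3) by (auto simp: less_Suc_eq)
    qed
    moreover have "finite (D \<union> Q)" using D(1) Q(1) by simp
    ultimately show ?thesis using W1(1) by blast
  qed
qed

section \<open>Polynomial growth\<close>

definition poly_bounded :: "(nat \<Rightarrow> nat) \<Rightarrow> bool" where
  "poly_bounded f \<longleftrightarrow> (\<exists>m. \<forall>n\<ge>2. f n \<le> n ^ m)"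

lemma poly_bounded_const: "poly_bounded (\<lambda>n. c)"
  unfolding poly_bounded_def
proof (intro exI[of _ c] allI impI)
  fix n :: nat assume "2 \<le> n"
  have "c \<le> 2 ^ c" by simp
  also have "\<dots> \<le> n ^ c" using \<open>2 \<le> n\<close> by (rule power_mono) simp
  finally show "c \<le> n ^ c" .
qed

lemma poly_bounded_ident: "poly_bounded (\<lambda>n. n)"
  unfolding poly_bounded_def by (intro exI[of _ 1]) simp

text \<open>For \<open>n\<close> at least \<open>2\<close>, the factor \<open>2\<close> is absorbed
  by raising the exponent by one.\<close>

lemma poly_bounded_add:
  assumes "poly_bounded f" "poly_bounded g"
  shows "poly_bounded (\<lambda>n. f n + g n)"
proof -
  obtain i j where ij: "\<And>n. 2 \<le> n \<Longrightarrow> f n \<le> n ^ i" "\<And>n. 2 \<le> n \<Longrightarrow> g n \<le> n ^ j"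
    using assms unfolding poly_bounded_def by blast
  have "f n + g n \<le> n ^ Suc (i + j)" if "2 \<le> n" for n
  proof -
    have "n ^ i \<le> n ^ (i + j)" "n ^ j \<le> n ^ (i + j)" using that by (auto intro: power_increasing)
    then have "f n + g n \<le> 2 * n ^ (i + j)" using ij[OF that] by linarith
    also have "\<dots> \<le> n * n ^ (i + j)" using that by (rule mult_le_mono1)
    finally show ?thesis by simp
  qed
  then show ?thesis unfolding poly_bounded_def by blast
qed

lemma poly_bounded_mult:
  assumes "poly_bounded f" "poly_bounded g"
  shows "poly_bounded (\<lambda>n. f n * g n)"
proof -
  obtain i j where ij: "\<And>n. 2 \<le> n \<Longrightarrow> f n \<le> n ^ i" "\<And>n. 2 \<le> n \<Longrightarrow> g n \<le> n ^ j"
    using assms unfolding poly_bounded_def by blast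
  then have "f n * g n \<le> n ^ (i + j)" if "2 \<le> n" for n
    using that by (simp add: power_add mult_le_mono)
  then show ?thesis unfolding poly_bounded_def by blast
qed

lemma poly_bounded_power: "poly_bounded f \<Longrightarrow> poly_bounded (\<lambda>n. f n ^ c)"
  by (induction c) (auto intro: poly_bounded_const poly_bounded_mult)

text \<open>At \<open>n = 2 ^ j\<close> the question is whether \<open>j * m < 2 ^ j\<close>, which
  follows from \<open>j * j < 2 ^ j\<close> once \<open>j\<close> is at least \<open>m\<close> and
  \<open>5\<close>.\<close>

lemma poly_bounded_less_exp:
  assumes "poly_bounded f"
  shows "\<exists>n\<ge>B. f n < 2 ^ n"
proof -
  obtain m where m: "\<And>n. 2 \<le> n \<Longrightarrow> f n \<le> n ^ m" using assms unfolding poly_bounded_def by blast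
  define j where "j = m + B + 5"
  have sq: "i * i < 2 ^ i" if "5 \<le> i" for i :: nat
    using that
  proof (induction i rule: dec_induct)
    case (step i)
    have "5 * i \<le> i * i" using step by (intro mult_le_mono1) simp
    then have "Suc i * Suc i \<le> 2 * (i * i)" using step(1) unfolding mult_Suc mult_Suc_right by linarith
    then show ?case using step by simp
  qed simp
  have "f (2 ^ j) \<le> (2 ^ j) ^ m" by (rule m) (simp add: j_def power_add)
  also have "\<dots> = 2 ^ (j * m)" by (simp add: power_mult)
  also have "j * m \<le> j * j" by (simp add: j_def)
  then have "(2::nat) ^ (j * m) \<le> 2 ^ (j * j)" by simp
  also have "(2::nat) ^ (j * j) < 2 ^ (2 ^ j)" using sq[of j] by (simp add: j_def)
  finally have "f (2 ^ j) < 2 ^ (2 ^ j)" .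
  moreover have "B \<le> 2 ^ j" using less_exp[of j] j_def by linarith
  ultimately show ?thesis by blast
qed

text \<open>Since \<open>0 ^ 0 = 1\<close>, the power alone is not monotone in the exponent at
  \<open>n = 0\<close>; there the additive constant compensates.\<close>

lemma clock_mono:
  assumes "c \<le> c'"
  shows "n ^ c + c \<le> n ^ c' + (c' :: nat)"
proof (cases "n = 0 \<and> c < c'")
  case True
  then show ?thesis by (cases c) auto
next
  case False
  then have "n ^ c \<le> n ^ c'"
    using assms by (cases "c = c'") (auto intro: power_increasing)
  then show ?thesis using assms by simp
qed

text \<open>The number \<open>a\<close> encodes two machines and an exponent \<open>c\<close>, that is, a candidate for a complete
  pair given by the complements of the two languages; \<open>side a s\<close> are the components of the pair
  that is to be irreducible to it.\<close>

definition pair_machine :: "nat \<Rightarrow> bool \<Rightarrow> machine" where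
  "pair_machine a s = nth_machine
     (if s then fst (prod_decode (snd (prod_decode a))) else fst (prod_decode a))"

definition pair_clock :: "nat \<Rightarrow> nat \<Rightarrow> nat" where
  "pair_clock a n = (let c = snd (prod_decode (snd (prod_decode a))) in n ^ c + c)"

definition side :: "nat \<Rightarrow> bool \<Rightarrow> nat set \<Rightarrow> nat set" where
  "side a s V = {x. \<forall>y. length y = length (bits x) \<longrightarrow> witness a s x y \<notin> V}"

text \<open>If both machines obey the clock, \<open>z\<close> lies in both components of the
  candidate, which is then not disjoint.\<close>

definition killed :: "nat \<Rightarrow> nat set \<Rightarrow> bool" where
  "killed a V \<longleftrightarrow>
     (\<exists>z. \<forall>s. \<not> accepts_within (pair_machine a s) V z (pair_clock a (length (bits z))))"

text \<open>The alternative to halting says that the machine exceeds the clock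
  \<open>n ^ d + d\<close>; either way it is no reduction within that clock.\<close>

definition diagonalized :: "nat \<Rightarrow> nat \<Rightarrow> nat \<Rightarrow> nat set \<Rightarrow> bool" where
  "diagonalized a e d V \<longleftrightarrow> (\<exists>x k c s.
     (step (nth_machine e) V ^^ k) (init (nth_machine e) x) c \<and>
     (halted (nth_machine e) V c \<or> k = length (bits x) ^ d + d + 1) \<and>
     x \<in> side a s V \<and> accepts (pair_machine a s) V (tape_number (snd c ! 0)))"

text \<open>This is what makes the two sides disjoint.\<close>

definition covered :: "nat \<Rightarrow> nat set \<Rightarrow> bool" where
  "covered a W \<longleftrightarrow> (\<forall>x. \<exists>s y. length y = length (bits x) \<and> witness a s x y \<in> W)"

definition forced :: "nat set \<Rightarrow> nat \<Rightarrow> (nat set \<Rightarrow> bool) \<Rightarrow> bool" where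
  "forced W B \<Phi> \<longleftrightarrow> (\<forall>W'. (\<forall>u<B. u \<in> W' \<longleftrightarrow> u \<in> W) \<longrightarrow> \<Phi> (oracle_of W'))"

text \<open>The undecided part of \<open>W\<close> is full by default, so witnesses are present
  unless a stage removes them. A candidate may lose its covering only when it is killed for
  good.\<close>

definition condition :: "nat set \<Rightarrow> nat \<Rightarrow> bool" where
  "condition W B \<longleftrightarrow> {B..} \<subseteq> W \<and> (\<forall>a. covered a W \<or> forced W B (killed a))"

section \<open>Fresh witnesses and the single stage\<close>

lemma oracle_machine_pair_machine: "oracle_machine (pair_machine a s)"
  by (simp add: pair_machine_def oracle_machine_nth_machine)

lemma forced_mono:
  assumes "forced W B \<Phi>" "B \<le> B'" "\<forall>u<B. u \<in> W' \<longleftrightarrow> u \<in> W"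
  shows "forced W' B' \<Phi>"
  using assms unfolding forced_def by (meson less_le_trans)

lemma exists_fresh_witness:
  assumes "finite Q" "card Q < 2 ^ length (bits x)"
  shows "\<exists>y. length y = length (bits x) \<and> witness a s x y \<notin> Q"
proof (rule ccontr)
  let ?Y = "{y :: bool list. length y = length (bits x)}"
  assume "\<not> ?thesis"
  then have "witness a s x ` ?Y \<subseteq> Q" by blast
  moreover have "inj_on (witness a s x) ?Y" by (auto simp: inj_on_def witness_inject)
  ultimately have "card ?Y \<le> card Q" using assms(1) by (metis card_inj_on_le)
  moreover have "card ?Y = 2 ^ length (bits x)"
    using card_lists_length_eq[of "UNIV :: bool set" "length (bits x)"] by simp
  ultimately show False using assms(2) by simp
qed

text \<open>There are \<open>2 ^ n\<close> inputs of length \<open>Suc n\<close>, and distinct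
  inputs would be spoiled by distinct elements of \<open>D\<close>.\<close>

lemma exists_fresh_input:
  assumes "finite D" "card D < 2 ^ n"
  shows "\<exists>x. length (bits x) = Suc n \<and> (\<forall>s y. length y = Suc n \<longrightarrow> witness a s x y \<notin> D)"
proof (rule ccontr)
  let ?X = "{2 ^ n..<2 ^ Suc n :: nat}"
  assume "\<not> ?thesis"
  then have "\<forall>x\<in>?X. \<exists>p. length (snd p) = Suc n \<and> witness a (fst p) x (snd p) \<in> D"
    by (metis atLeastLessThan_iff fst_conv length_bits_eq snd_conv)
  then obtain p where p: "\<And>x. x \<in> ?X \<Longrightarrow> length (snd (p x)) = Suc n \<and> witness a (fst (p x)) x (snd (p x)) \<in> D"
    by metis
  let ?f = "\<lambda>x. witness a (fst (p x)) x (snd (p x))"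
  have "inj_on ?f ?X"
  proof (rule inj_onI)
    fix x x' assume *: "x \<in> ?X" "x' \<in> ?X" "?f x = ?f x'"
    then have "length (bits x) = Suc n" "length (bits x') = Suc n"
      using length_bits_eq[of n x] length_bits_eq[of n x'] by auto
    then show "x = x'" using p[OF *(1)] p[OF *(2)] *(3) witness_inject by metis
  qed
  moreover have "?f ` ?X \<subseteq> D" using p by blast
  ultimately have "card ?X \<le> card D" using assms(1) by (metis card_inj_on_le)
  then show False using assms(2) by simp
qed

lemma witness_bounds:
  assumes "length y = length (bits x)"
  shows "length (bits x) < witness a s x y" "witness a s x y < 2 ^ (4 * a + 4 + 2 * length (bits x))"
proof -
  let ?k = "4 * a + 2 * of_bool s" and ?w = "interleave (bits x) y"
  have l: "length ?w = 2 * length (bits x)" using assms by (simp add: length_interleave)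
  have "length (bits x) \<le> ?k + 1 + length ?w" using l by simp
  also have "\<dots> < 2 ^ (?k + 1 + length ?w)" by (rule less_exp)
  also have "\<dots> \<le> witness a s x y" unfolding witness_def by (rule tagged_ge)
  finally show "length (bits x) < witness a s x y" .
  have "witness a s x y < 2 ^ (?k + 2 + length ?w)" unfolding witness_def by (rule tagged_less)
  also have "\<dots> \<le> 2 ^ (4 * a + 4 + 2 * length (bits x))"
    by (rule power_increasing) (use l in auto)
  finally show "witness a s x y < 2 ^ (4 * a + 4 + 2 * length (bits x))" .
qed

text \<open>Removing all witnesses of one input destroys the covering for \<open>a\<close>. It is
  either repaired by a single new witness, which diagonalizes, or replaced by the forced killing of
  \<open>a\<close>.\<close>

lemma stage_covered:
  assumes cond: "condition W B" and cov: "covered a W"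
  shows "\<exists>W' B'. B < B' \<and> (\<forall>u<B. u \<in> W' \<longleftrightarrow> u \<in> W) \<and> condition W' B' \<and>
    forced W' B' (\<lambda>V. killed a V \<or> diagonalized a e d V)"
proof -
  define c where "c = snd (prod_decode (snd (prod_decode a)))"
  \<comment> \<open>Reaching \<open>t\<close> steps already violates the clock of the reduction.
    \<open>tz\<close> bounds the clock of the pair on the output, and \<open>L\<close> bounds both
    of these and the bit lengths of the witnesses.\<close>
  define t where "t n = n ^ d + d + 1" for n :: nat
  define tz where "tz n = (n + t n) ^ c + c" for n
  define L where "L n = t n + tz n + (4 * a + 4 + 2 * n)" for n
  \<comment> \<open>The cubic term bounds the number of frozen values, the linear one the queries of
    the two runs. The factor \<open>2\<close> is there because only \<open>2 ^ n\<close> inputs have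
    length \<open>m = Suc n\<close>.\<close>
  have "poly_bounded (\<lambda>n. 2 * (L n * (L n * L n) + L n))"
    unfolding L_def tz_def t_def
    by (intro poly_bounded_add poly_bounded_mult poly_bounded_power poly_bounded_const poly_bounded_ident)
  from poly_bounded_less_exp[OF this, of "Suc B"] obtain m where
    m: "Suc B \<le> m" "2 * (L m * (L m * L m) + L m) < 2 ^ m" by blast
  then obtain n where n: "m = Suc n" by (cases m) auto
  define l where "l = L m"
  have l: "l * (l * l) + l < 2 ^ n" using m(2) by (simp add: l_def n)
  have ltz: "tz m \<le> l" "t m \<le> l" "4 * a + 4 + 2 * m \<le> l" by (auto simp: l_def L_def)
  have "B < m" using m(1) by simp
  have "B < 2 ^ l" using less_exp[of l] ltz(3) \<open>B < m\<close> by linarith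
  define S where "S = {witness a s x y | s x y. length (bits x) = m \<and> length y = m}"
  have S_ge: "B \<le> u" if u: "u \<in> S" for u
  proof -
    obtain s x y where "u = witness a s x y" "length (bits x) = m" "length y = m"
      using u unfolding S_def by blast
    then show ?thesis using witness_bounds(1)[of y x a s] \<open>B < m\<close> by simp
  qed
  have S_less: "u < 2 ^ l" if u: "u \<in> S" for u
  proof -
    obtain s x y where "u = witness a s x y" "length (bits x) = m" "length y = m"
      using u unfolding S_def by blast
    then have "u < 2 ^ (4 * a + 4 + 2 * m)" using witness_bounds(2)[of y x a s] by simp
    also have "\<dots> \<le> 2 ^ l" using ltz(3) by (intro power_increasing) auto
    finally show ?thesis .
  qed
  \<comment> \<open>Only witnesses for \<open>a\<close> at length \<open>m\<close> may vary. They
    lie between \<open>B\<close> and \<open>2 ^ l\<close>, so earlier decisions and the full tail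
    survive.\<close>
  define \<W> where "\<W> = {W'. \<forall>u. u \<notin> S \<longrightarrow> (u \<in> W' \<longleftrightarrow> u \<in> W)}"
  have "W \<in> \<W>" by (simp add: \<W>_def)
  then obtain W0 D where W0: "W0 \<in> \<W>" and D: "finite D" "card D \<le> l * card (coding_numbers \<inter> {..<2 ^ l})"
    and fixed: "\<forall>W\<in>\<W>. (\<forall>u\<in>D. u \<in> W \<longleftrightarrow> u \<in> W0) \<longrightarrow>
       (\<forall>q\<in>coding_numbers \<inter> {..<2 ^ l}. q \<in> oracle_of W \<longleftrightarrow> q \<in> oracle_of W0)"
    using fix_coding_numbers[of \<W> "2 ^ l" l] by blast
  have "card D \<le> l * (l * l)"
    using D(2) card_coding_numbers[of l] by (meson le_trans mult_le_mono2)
  then have cardD: "card D < 2 ^ n" using l by simp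
  obtain x where x: "length (bits x) = m" "\<And>s y. length y = m \<Longrightarrow> witness a s x y \<notin> D"
    using exists_fresh_input[OF D(1) cardD, of a] n by blast
  define Sx where "Sx = {witness a s x y | s y. length y = m}"
  have "Sx \<subseteq> S" using x(1) unfolding Sx_def S_def by blast
  have "Sx \<inter> D = {}" using x(2) unfolding Sx_def by blast
  \<comment> \<open>Agreement with \<open>W0\<close> on \<open>D\<close> freezes the coding numbers;
    as \<open>Sx\<close> avoids \<open>D\<close>, all witnesses of \<open>x\<close> can be removed
    at the same time.\<close>
  define W1 where "W1 = {u. if u \<in> D then u \<in> W0 else u \<in> W \<and> u \<notin> Sx}"
  have W1: "W1 \<in> \<W>" using W0 \<open>Sx \<subseteq> S\<close> unfolding \<W>_def W1_def by auto
  have W1D: "\<forall>u\<in>D. u \<in> W1 \<longleftrightarrow> u \<in> W0" by (simp add: W1_def)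
  have W1x: "u \<notin> W1" if "u \<in> Sx" for u
    using that \<open>Sx \<inter> D = {}\<close> unfolding W1_def by auto
  have agree: "u \<in> W' \<longleftrightarrow> u \<in> W" if "W' \<in> \<W>" "u < B" for W' u
    using that S_ge[of u] unfolding \<W>_def by fastforce
  have tail: "{2 ^ l..} \<subseteq> W'" if "W' \<in> \<W>" for W'
  proof
    fix u :: nat assume u: "u \<in> {2 ^ l..}"
    then have "u \<notin> S" using S_less[of u] by auto
    moreover have "u \<in> W" using cond u \<open>B < 2 ^ l\<close> unfolding condition_def by auto
    ultimately show "u \<in> W'" using that unfolding \<W>_def by blast
  qed
  have other: "covered a' W' \<or> forced W' (2 ^ l) (killed a')" if "W' \<in> \<W>" "a' \<noteq> a" for W' a'
  proof (cases "covered a' W")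
    case True
    have "witness a' s x y \<notin> S" if "length y = length (bits x)" for s x y
      using that \<open>a' \<noteq> a\<close> unfolding S_def by (auto simp: witness_inject)
    then have "covered a' W'" using True \<open>W' \<in> \<W>\<close> unfolding covered_def \<W>_def by blast
    then show ?thesis ..
  next
    case False
    then have "forced W B (killed a')" using cond unfolding condition_def by blast
    then have "forced W' (2 ^ l) (killed a')"
      by (rule forced_mono) (use \<open>B < 2 ^ l\<close> agree[OF that(1)] in auto)
    then show ?thesis ..
  qed
  \<comment> \<open>At length \<open>m\<close> there are more words \<open>y\<close> than elements
    of \<open>D\<close>, and a witness outside \<open>D\<close> is still present since
    \<open>W\<close> is full from \<open>B\<close> on.\<close>
  have cov1: "\<exists>s y. length y = length (bits x') \<and> witness a s x' y \<in> W1" if "x' \<noteq> x" for x'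
  proof (cases "length (bits x') = m")
    case True
    have "card D < 2 ^ length (bits x')" using cardD True n by simp
    then obtain y where y: "length y = length (bits x')" "witness a True x' y \<notin> D"
      using exists_fresh_witness[OF D(1)] by blast
    have "witness a True x' y \<in> S" using y(1) True unfolding S_def by blast
    then have "witness a True x' y \<in> W" using S_ge cond unfolding condition_def by auto
    moreover have "witness a True x' y \<notin> Sx"
      using that y(1) x(1) unfolding Sx_def by (auto simp: witness_inject)
    ultimately show ?thesis using y unfolding W1_def by auto
  next
    case False
    obtain s y where y: "length y = length (bits x')" "witness a s x' y \<in> W"
      using cov unfolding covered_def by blast
    then have "witness a s x' y \<notin> S" using False unfolding S_def by (auto simp: witness_inject)
    then show ?thesis using y W1 unfolding \<W>_def by blast
  qed
  let ?F = "nth_machine e" and ?O = "oracle_of W1"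
  obtain k cfg where run: "(step ?F ?O ^^ k) (init ?F x) cfg" "k \<le> t m" "halted ?F ?O cfg \<or> k = t m"
    using exists_run by blast
  define z where "z = tape_number (snd cfg ! 0)"
  define T where "T = pair_clock a (length (bits z))"
  have "length (bits z) \<le> m + t m"
    using output_length[OF oracle_machine_nth_machine run(1)] run(2) x(1) unfolding z_def by simp
  then have "T \<le> tz m" unfolding T_def pair_clock_def tz_def c_def Let_def
    by (intro add_mono power_mono) auto
  then have T: "(2::nat) ^ T \<le> 2 ^ l" "T \<le> tz m" using ltz by (auto intro: power_increasing)
  show ?thesis
  proof (cases "\<exists>s. accepts_within (pair_machine a s) ?O z T")
    case True
    then obtain s where "accepts_within (pair_machine a s) ?O z T" by blast
    from accepts_within_queries[OF oracle_machine_pair_machine this]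
    obtain Q2 where Q2: "finite Q2" "card Q2 \<le> T" "Q2 \<subseteq> {..<2 ^ T}"
      "\<And>V. \<forall>u\<in>Q2. u \<in> ?O \<longleftrightarrow> u \<in> V \<Longrightarrow> accepts_within (pair_machine a s) V z T" by blast
    from run_queries[OF oracle_machine_nth_machine run(1)]
    obtain Q1 where Q1: "finite Q1" "card Q1 \<le> k" "Q1 \<subseteq> {..<2 ^ k}"
      "\<And>V. \<forall>u\<in>Q1. u \<in> ?O \<longleftrightarrow> u \<in> V \<Longrightarrow> (step ?F V ^^ k) (init ?F x) cfg" by blast
    have "card (Q1 \<union> Q2) \<le> t m + tz m"
      using card_Un_le[of Q1 Q2] Q1(2) Q2(2) run(2) T(2) by linarith
    also have "\<dots> \<le> l" by (simp add: l_def L_def)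
    also have "\<dots> < 2 ^ length (bits x)" using l x(1) n by simp
    finally obtain y where y: "length y = m" "witness a (\<not> s) x y \<notin> Q1 \<union> Q2"
      using exists_fresh_witness[of "Q1 \<union> Q2" x a "\<not> s"] Q1(1) Q2(1) x(1) by auto
    \<comment> \<open>The new witness is on the other side, so \<open>x\<close> stays in
      \<open>side a s\<close> while \<open>z\<close> is accepted by the machine for
      \<open>s\<close>.\<close>
    define w where "w = witness a (\<not> s) x y"
    have w: "w \<in> Sx" using y(1) unfolding w_def Sx_def by blast
    define W2 where "W2 = insert w W1"
    have W2: "W2 \<in> \<W>" using W1 w \<open>Sx \<subseteq> S\<close> unfolding W2_def \<W>_def by auto
    have W2D: "\<forall>u\<in>D. u \<in> W2 \<longleftrightarrow> u \<in> W0"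
      using W1D w \<open>Sx \<inter> D = {}\<close> unfolding W2_def by auto
    have "(2::nat) ^ k \<le> 2 ^ l" using run(2) ltz(2) by (intro power_increasing) auto
    then have Q_less: "u < 2 ^ l" if "u \<in> Q1 \<union> Q2" for u
      using that Q1(3) Q2(3) T(1) by (metis Un_iff lessThan_iff less_le_trans subset_iff)
    \<comment> \<open>Coding numbers are frozen through \<open>D\<close>; among the others only
      \<open>w\<close> changes, and it was chosen outside the queries.\<close>
    have same: "u \<in> ?O \<longleftrightarrow> u \<in> oracle_of W2" if "u \<in> Q1 \<union> Q2" for u
    proof (cases "u \<in> coding_numbers")
      case True
      then show ?thesis using fixed W1 W1D W2 W2D Q_less[OF that] by (metis IntI lessThan_iff)
    next
      case False
      then show ?thesis using that y(2) by (auto simp: noncoding_mem_oracle_of W2_def w_def)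
    qed
    have "diagonalized a e d (oracle_of W')" if W': "\<forall>u<2 ^ l. u \<in> W' \<longleftrightarrow> u \<in> W2" for W'
    proof -
      have cong: "u \<in> oracle_of W' \<longleftrightarrow> u \<in> oracle_of W2" if "u < 2 ^ l" for u
        using oracle_of_cong[of "2 ^ l" W' W2 u] W' that by blast
      have q: "\<forall>u\<in>Q1 \<union> Q2. u \<in> ?O \<longleftrightarrow> u \<in> oracle_of W'" using same cong Q_less by blast
      have "(step ?F (oracle_of W') ^^ k) (init ?F x) cfg" using q Q1(4) by blast
      moreover have "halted ?F (oracle_of W') cfg \<or> k = length (bits x) ^ d + d + 1"
        using run(3) halted_cong[of ?F ?O cfg "oracle_of W'"] by (simp add: t_def x(1))
      moreover have "x \<in> side a s (oracle_of W')"
      proof -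
        have "witness a s x y' \<notin> oracle_of W'" if "length y' = m" for y'
        proof -
          have "witness a s x y' \<in> Sx" using that unfolding Sx_def by blast
          moreover have "witness a s x y' \<noteq> w"
            unfolding w_def using that y(1) x(1) by (simp add: witness_inject)
          ultimately have "witness a s x y' \<notin> W2" "witness a s x y' < 2 ^ l"
            using W1x S_less \<open>Sx \<subseteq> S\<close> unfolding W2_def by auto
          then show ?thesis using W' by (simp add: witness_mem_oracle_of)
        qed
        then show ?thesis unfolding side_def by (simp add: x(1))
      qed
      moreover have "accepts (pair_machine a s) (oracle_of W') (tape_number (snd cfg ! 0))"
        using Q2(4)[of "oracle_of W'"] q accepts_within_imp_accepts unfolding z_def by blast
      ultimately show ?thesis unfolding diagonalized_def by blast
    qed
    then have "forced W2 (2 ^ l) (\<lambda>V. killed a V \<or> diagonalized a e d V)"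
      unfolding forced_def by blast
    moreover have "covered a W2"
      unfolding covered_def
    proof
      fix x'
      show "\<exists>s y. length y = length (bits x') \<and> witness a s x' y \<in> W2"
      proof (cases "x' = x")
        case True
        then show ?thesis using y(1) x(1) unfolding W2_def w_def
          by (intro exI[of _ "\<not> s"] exI[of _ y]) simp
      next
        case False
        then show ?thesis using cov1[of x'] unfolding W2_def by blast
      qed
    qed
    then have "condition W2 (2 ^ l)" unfolding condition_def using tail[OF W2] other[OF W2] by metis
    ultimately show ?thesis using \<open>B < 2 ^ l\<close> agree[OF W2] by blast
  next
    case False
    \<comment> \<open>Rejection on all branches persists because every possible query lies below
      \<open>2 ^ T\<close>, hence below the new bound.\<close>
    have kill: "forced W1 (2 ^ l) (killed a)"
      unfolding forced_def killed_def
    proof (intro allI impI exI[of _ z])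
      fix W' s assume W': "\<forall>u<2 ^ l. u \<in> W' \<longleftrightarrow> u \<in> W1"
      have "u \<in> oracle_of W' \<longleftrightarrow> u \<in> ?O" if "u < 2 ^ T" for u
        using oracle_of_cong[of "2 ^ l" W' W1 u] W' that T(1) by (meson less_le_trans)
      then have "accepts_within (pair_machine a s) (oracle_of W') z T \<longleftrightarrow>
          accepts_within (pair_machine a s) ?O z T"
        by (rule accepts_within_cong[OF oracle_machine_pair_machine])
      then show "\<not> accepts_within (pair_machine a s) (oracle_of W') z (pair_clock a (length (bits z)))"
        using False unfolding T_def by blast
    qed
    then have "condition W1 (2 ^ l)" unfolding condition_def using tail[OF W1] other[OF W1] by metis
    moreover have "forced W1 (2 ^ l) (\<lambda>V. killed a V \<or> diagonalized a e d V)"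
      using kill unfolding forced_def by blast
    ultimately show ?thesis using \<open>B < 2 ^ l\<close> agree[OF W1] by blast
  qed
qed

text \<open>Where the covering is already lost, the killing is already forced, and it is enough to
  raise the bound.\<close>

lemma stage:
  assumes "condition W B"
  shows "\<exists>W' B'. B < B' \<and> (\<forall>u<B. u \<in> W' \<longleftrightarrow> u \<in> W) \<and> condition W' B' \<and>
    forced W' B' (\<lambda>V. killed a V \<or> diagonalized a e d V)"
proof (cases "covered a W")
  case True
  then show ?thesis using stage_covered[OF assms] by blast
next
  case False
  then have k: "forced W B (killed a)" using assms unfolding condition_def by blast
  have mono: "forced W B \<Phi> \<Longrightarrow> forced W (Suc B) \<Phi>" for \<Phi>
    by (erule forced_mono) auto
  then have "condition W (Suc B)" using assms unfolding condition_def by fastforce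
  moreover have "forced W (Suc B) (\<lambda>V. killed a V \<or> diagonalized a e d V)"
    using mono[OF k] unfolding forced_def by blast
  ultimately show ?thesis by blast
qed

text \<open>Stages are iterated by dependent choice through an enumeration of all triples; a forced
  property holds for the limit because the limit extends each decided segment.\<close>

lemma generic_oracle:
  "\<exists>W. (\<forall>a e d. killed a (oracle_of W) \<or> diagonalized a e d (oracle_of W)) \<and>
    (\<forall>a. killed a (oracle_of W) \<or> covered a W)"
proof -
  define req where "req i = (\<lambda>V. let p = prod_decode i; q = prod_decode (snd p) in
    killed (fst p) V \<or> diagonalized (fst p) (fst q) (snd q) V)" for i
  have "\<exists>f :: nat \<Rightarrow> nat set \<times> nat. \<forall>i. (condition (fst (f i)) (snd (f i)) \<and> i \<le> snd (f i)) \<and>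
     (snd (f i) \<le> snd (f (Suc i)) \<and> (\<forall>u<snd (f i). u \<in> fst (f (Suc i)) \<longleftrightarrow> u \<in> fst (f i)) \<and>
      forced (fst (f (Suc i))) (snd (f (Suc i))) (req i))"
  proof (rule dependent_nat_choice)
    have "covered a UNIV" for a unfolding covered_def by (metis UNIV_I)
    then show "\<exists>p :: nat set \<times> nat. condition (fst p) (snd p) \<and> 0 \<le> snd p"
      by (intro exI[of _ "(UNIV, 0)"]) (simp add: condition_def)
  next
    fix p :: "nat set \<times> nat" and i
    assume p: "condition (fst p) (snd p) \<and> i \<le> snd p"
    let ?q = "prod_decode (snd (prod_decode i))"
    have "condition (fst p) (snd p)" using p by blast
    from stage[OF this, of "fst (prod_decode i)" "fst ?q" "snd ?q"]
    obtain W' B' where "snd p < B'" "\<forall>u<snd p. u \<in> W' \<longleftrightarrow> u \<in> fst p" "condition W' B'"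
      "forced W' B' (req i)"
      unfolding req_def Let_def by blast
    then show "\<exists>p'. (condition (fst p') (snd p') \<and> Suc i \<le> snd p') \<and>
        (snd p \<le> snd p' \<and> (\<forall>u<snd p. u \<in> fst p' \<longleftrightarrow> u \<in> fst p) \<and> forced (fst p') (snd p') (req i))"
      using p by (intro exI[of _ "(W', B')"]) auto
  qed
  then obtain f :: "nat \<Rightarrow> nat set \<times> nat" where f: "\<And>i. condition (fst (f i)) (snd (f i))" "\<And>i. i \<le> snd (f i)"
    "\<And>i. snd (f i) \<le> snd (f (Suc i))"
    "\<And>i u. u < snd (f i) \<Longrightarrow> u \<in> fst (f (Suc i)) \<longleftrightarrow> u \<in> fst (f i)"
    "\<And>i. forced (fst (f (Suc i))) (snd (f (Suc i))) (req i)" by blast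
  have mono: "i \<le> j \<Longrightarrow> snd (f i) \<le> snd (f j)" for i j
    using f(3) by (rule lift_Suc_mono_le[of "\<lambda>i. snd (f i)"])
  have stable: "i \<le> j \<Longrightarrow> u < snd (f i) \<Longrightarrow> u \<in> fst (f j) \<longleftrightarrow> u \<in> fst (f i)" for i j u
  proof (induction j rule: dec_induct)
    case (step j)
    then have "u < snd (f j)" using mono[of i j] by simp
    then show ?case using f(4)[of u j] step by blast
  qed simp
  \<comment> \<open>The bound at stage \<open>Suc u\<close> exceeds \<open>u\<close>, so
    \<open>u\<close> is settled from there on.\<close>
  define W where "W = {u. u \<in> fst (f (Suc u))}"
  have W: "u \<in> W \<longleftrightarrow> u \<in> fst (f i)" if "u < snd (f i)" for u i
  proof -
    have "u < snd (f (Suc u))" using f(2)[of "Suc u"] by simp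
    then show ?thesis using stable[of i "Suc u" u] stable[of "Suc u" i u] that
      unfolding W_def by (cases "i \<le> Suc u") auto
  qed
  have holds: "\<Phi> (oracle_of W)" if "forced (fst (f i)) (snd (f i)) \<Phi>" for i \<Phi>
    using that W unfolding forced_def by blast
  show ?thesis
  proof (intro exI[of _ W] conjI allI)
    fix a e d
    have "req (prod_encode (a, prod_encode (e, d))) (oracle_of W)" by (rule holds[OF f(5)])
    then show "killed a (oracle_of W) \<or> diagonalized a e d (oracle_of W)" by (simp add: req_def)
  next
    fix a
    show "killed a (oracle_of W) \<or> covered a W"
    proof (cases "\<exists>i. forced (fst (f i)) (snd (f i)) (killed a)")
      case True
      then show ?thesis using holds by blast
    next
      case False
      have "\<exists>s y. length y = length (bits x) \<and> witness a s x y \<in> W" for x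
      proof -
        \<comment> \<open>All witnesses of \<open>x\<close> for \<open>a\<close> lie below this
          number, so at that stage they are settled and one found there persists.\<close>
        let ?i = "2 ^ (4 * a + 4 + 2 * length (bits x))"
        have "covered a (fst (f ?i))" using f(1) False unfolding condition_def by blast
        then obtain s y where y: "length y = length (bits x)" "witness a s x y \<in> fst (f ?i)"
          unfolding covered_def by blast
        have "witness a s x y < snd (f ?i)"
          using witness_bounds(2)[OF y(1)] f(2)[of ?i] by (meson less_le_trans)
        then show ?thesis using W y by blast
      qed
      then show ?thesis unfolding covered_def by blast
    qed
  qed
qed

section \<open>Refutation of completeness\<close>

lemma side_in_CoNP: "side a s V \<in> CoNP V"
proof -
  let ?k = "4 * a + 2 * of_bool s"
  have "- side a s V = {x. accepts (guess_machine ?k) V x}"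
    by (auto simp: side_def accepts_guess_machine witness_def)
  then show ?thesis
    unfolding CoNP_def NP_def NTIME_def using oracle_machine_guess_machine guess_machine_time by blast
qed

text \<open>Any larger exponent is allowed, so that both components of a pair can share one
  clock.\<close>

lemma CoNP_clocked:
  assumes "U \<in> CoNP V"
  obtains e c where "U = {x. \<not> accepts (nth_machine e) V x}"
    "\<And>c'. c \<le> c' \<Longrightarrow> runs_in_time (nth_machine e) V (\<lambda>n. n ^ c' + c')"
proof -
  obtain M c where M: "- U = {x. accepts M V x}" "oracle_machine M" "runs_in_time M V (\<lambda>n. n ^ c + c)"
    using assms unfolding CoNP_def NP_def NTIME_def by blast
  obtain e where e: "nth_machine e = M" using nth_machine_surj[OF M(2)] .
  show ?thesis
  proof (rule that)
    show "U = {x. \<not> accepts (nth_machine e) V x}" using M(1) e by blast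
    show "runs_in_time (nth_machine e) V (\<lambda>n. n ^ c' + c')" if "c \<le> c'" for c'
      using M(3) clock_mono[OF that] unfolding runs_in_time_def e by (meson le_trans)
  qed
qed

theorem theorem5p1:
  "\<exists>V :: nat set. (\<nexists>P. complete_disjoint_CoNP_pair V P) \<and> E V = NE V"
proof -
  obtain W where W: "\<And>a e d. killed a (oracle_of W) \<or> diagonalized a e d (oracle_of W)"
    "\<And>a. killed a (oracle_of W) \<or> covered a W" using generic_oracle by blast
  define V where "V = oracle_of W"
  have "\<not> complete_disjoint_CoNP_pair V P" for P
  proof
    assume P: "complete_disjoint_CoNP_pair V P"
    then have dis: "fst P \<inter> snd P = {}" and co: "fst P \<in> CoNP V" "snd P \<in> CoNP V"
      unfolding complete_disjoint_CoNP_pair_def disjoint_CoNP_pair_def by auto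
    obtain e0 c0 where M0: "fst P = {x. \<not> accepts (nth_machine e0) V x}"
      "\<And>c. c0 \<le> c \<Longrightarrow> runs_in_time (nth_machine e0) V (\<lambda>n. n ^ c + c)"
      using CoNP_clocked[OF co(1)] by blast
    obtain e1 c1 where M1: "snd P = {x. \<not> accepts (nth_machine e1) V x}"
      "\<And>c. c1 \<le> c \<Longrightarrow> runs_in_time (nth_machine e1) V (\<lambda>n. n ^ c + c)"
      using CoNP_clocked[OF co(2)] by blast
    define a where "a = prod_encode (e0, prod_encode (e1, max c0 c1))"
    have machines: "pair_machine a False = nth_machine e0" "pair_machine a True = nth_machine e1"
      "pair_clock a = (\<lambda>n. n ^ max c0 c1 + max c0 c1)"
      by (auto simp: pair_machine_def pair_clock_def a_def fun_eq_iff Let_def)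
    have "runs_in_time (pair_machine a s) V (pair_clock a)" for s
      using M0(2)[of "max c0 c1"] M1(2)[of "max c0 c1"] by (cases s) (simp_all add: machines)
    \<comment> \<open>As the machines obey the clock, a killed candidate would have a number in both
      components.\<close>
    from accepts_within_iff[OF this order_refl] have not_killed: "\<not> killed a V"
      using dis unfolding killed_def M0(1) M1(1) machines(1,2)[symmetric] by blast
    then have cov: "covered a W" using W(2) V_def by blast
    have "side a False V \<inter> side a True V = {}"
    proof -
      have "x \<notin> side a False V \<or> x \<notin> side a True V" for x
        using cov unfolding covered_def side_def V_def
        by (auto simp: witness_mem_oracle_of) (metis (full_types))
      then show ?thesis by blast
    qed
    then have "disjoint_CoNP_pair V (side a False V, side a True V)"
      by (simp add: disjoint_CoNP_pair_def side_in_CoNP)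
    then have "poly_reducible V (side a False V, side a True V) P"
      using P unfolding complete_disjoint_CoNP_pair_def by blast
    then obtain g where g: "poly_time_computable V g"
      "\<And>x. x \<in> side a False V \<Longrightarrow> g x \<in> fst P" "\<And>x. x \<in> side a True V \<Longrightarrow> g x \<in> snd P"
      unfolding poly_reducible_def by auto
    from g(1) obtain M d where M: "oracle_machine M" "deterministic M"
      "runs_in_time M V (\<lambda>n. n ^ d + d)"
      "\<And>x. \<exists>c. reaches M V x c \<and> halted M V c \<and> tape_number (snd c ! 0) = g x"
      unfolding poly_time_computable_def by blast
    obtain e where e: "nth_machine e = M" using nth_machine_surj[OF M(1)] .
    have "diagonalized a e d V" using W(1) not_killed V_def by blast
    then obtain x k c s where run: "(step M V ^^ k) (init M x) c"
      "halted M V c \<or> k = length (bits x) ^ d + d + 1"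
      and x: "x \<in> side a s V" and acc: "accepts (pair_machine a s) V (tape_number (snd c ! 0))"
      unfolding diagonalized_def e by blast
    \<comment> \<open>The clock of the reduction excludes the truncated alternative; by determinism
      the halting configuration then carries \<open>g x\<close>.\<close>
    have "k \<le> length (bits x) ^ d + d" using M(3) run(1) unfolding runs_in_time_def by blast
    then have "halted M V c" using run(2) by auto
    moreover obtain k' c' where "(step M V ^^ k') (init M x) c'" "halted M V c'"
      "tape_number (snd c' ! 0) = g x"
      using M(4)[of x] unfolding reaches_def by (meson rtranclp_imp_relpowp)
    ultimately have "tape_number (snd c ! 0) = g x"
      using deterministic_halted_unique[OF M(2) run(1)] by blast
    \<comment> \<open>Since \<open>x\<close> is in \<open>side a s\<close>, the value
      \<open>g x\<close> must be rejected by the machine for \<open>s\<close>, which accepts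
      it.\<close>
    then show False using acc x g(2,3)[of x] M0(1) M1(1) machines by (cases s) auto
  qed
  moreover have "E V = NE V" using E_subset_NE NE_subset_E unfolding V_def by blast
  ultimately show ?thesis by blast
qed

end
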